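(* Let $\alpha=(\alpha_1,\dots,\alpha_\ell)$ be a composition of $n$, let $P\subseteq\mathrm{GL}_n(\mathbb{C})$ be the parabolic subgroup with block size vector $\alpha$, with Lie algebra $\mathfrak{p}$, and let $$\widetilde{C}_n=\{(r,s,i,j)\in\mathfrak{p}\times\mathfrak{p}^*\times\mathbb{C}^n\times(\mathbb{C}^n)^* : \overline{[r,s]+\mathbf{I}_n}=-\overline{ij}\}.$$ Let $(\check r,\check s,\check\imath,\check\jmath)\in\widetilde{C}_n$ be such that $\check r$ is diagonalizable. Then the eigenvalues of $\check r$ are distinct, and the $P$-orbit of $(\check r,\check s,\check\imath,\check\jmath)$ contains an element $(r,s,i,j)$ such that: (1) $r=\mathrm{diag}(-\rho_1,-\rho_2,\dots,-\rho_n)$ is diagonal; (2) all of the entries of $i$ are equal to $-1$ and all of the entries of $j$ are equal to $1$; (3) $s$ is a block lower Calogero--Moser matrix, that is, it has entries $$s_{pq}=\begin{cases}\sigma_p & \text{if } p=q,\\ (\rho_p-\rho_q)^{-1} & \text{if } p>q,\text{ or if } p<q \text{ with } (p,q) \text{ an entry in a diagonal block},\\ 0&\text{otherwise,}\end{cases}$$ for some $\sigma_1,\dots,\sigma_n\in\mathbb{C}$. Moreover, the element $(r,s,i,j)$ is unique up to (simultaneous) permutation of $(\rho_p,\sigma_p)_{p=1}^n$ by $S_\alpha$.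
   Context: Everything is over $\mathbb{C}$. A composition of $n$ is a sequence of positive integers with sum $n$. Let $\mathfrak{g}=\mathfrak{gl}_n(\mathbb{C})$; $\mathfrak{p}\subseteq\mathfrak{g}$ is the subalgebra of block upper triangular matrices with diagonal blocks of sizes $\alpha_1,\dots,\alpha_\ell$; $\mathfrak{u}\subseteq\mathfrak{p}$ is the subalgebra of strictly block upper triangular matrices; $P$ is the group of invertible elements of $\mathfrak{p}$. The trace pairing identifies $\mathfrak{p}^*$ with $\mathfrak{g}/\mathfrak{u}$, and an element $s\in\mathfrak{p}^*$ is described by the entries of a representing matrix; $\overline{x}$ is the class of $x\in\mathfrak{g}$ in $\mathfrak{g}/\mathfrak{u}$. Elements $i\in\mathbb{C}^n$ are column vectors and $j\in(\mathbb{C}^n)^*$ row vectors; $\mathbf{I}_n$ is the identity matrix. $P$ acts by $b.(r,s,i,j)=(brb^{-1},\overline{bsb^{-1}},bi,jb^{-1})$. A position $(p,q)$ is in a diagonal block if $p$ and $q$ both lie in one of the sets $I_k=\{\alpha_1+\dots+\alpha_{k-1}+1,\dots,\alpha_1+\dots+\alpha_k\}$. $S_\alpha=S_{\alpha_1}\times\dots\times S_{\alpha_\ell}\subseteq S_n$ is the subgroup of permutations preserving each $I_k$.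
   Formalization: The off-diagonal entries of s in (3) are (ρ_q−ρ_p)^{-1} instead of the printed (ρ_p−ρ_q)^{-1}; with r=diag(−ρ_1,…,−ρ_n) and i, j as in (2), the printed sign contradicts the equation defining C̃_n for every n≥2. *)

theory Defs
  imports "Jordan_Normal_Form.Spectral_Radius"
begin

text \<open>
  Rows and columns are numbered from 0, so a composition of \<open>n\<close> divides \<open>{0..<n}\<close> into consecutive
  blocks, themselves numbered from 0.
\<close>

definition composition :: "nat list \<Rightarrow> nat \<Rightarrow> bool" where
  "composition \<alpha> n \<longleftrightarrow> (\<forall>a\<in>set \<alpha>. 0 < a) \<and> sum_list \<alpha> = n"

definition blk :: "nat list \<Rightarrow> nat \<Rightarrow> nat set" where
  "blk \<alpha> k = {sum_list (take k \<alpha>) ..< sum_list (take (Suc k) \<alpha>)}"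

definition in_diag_block :: "nat list \<Rightarrow> nat \<Rightarrow> nat \<Rightarrow> bool" where
  "in_diag_block \<alpha> p q \<longleftrightarrow> (\<exists>k<length \<alpha>. p \<in> blk \<alpha> k \<and> q \<in> blk \<alpha> k)"

definition young_subgroup :: "nat list \<Rightarrow> (nat \<Rightarrow> nat) set" where
  "young_subgroup \<alpha> =
     {\<pi>. \<pi> permutes {..<sum_list \<alpha>} \<and> (\<forall>k<length \<alpha>. \<pi> ` blk \<alpha> k = blk \<alpha> k)}"

abbreviation gl_ring :: "nat \<Rightarrow> complex mat ring" where
  "gl_ring n \<equiv> ring_mat TYPE(complex) n ()"

definition parabolic :: "nat list \<Rightarrow> complex mat set" where
  "parabolic \<alpha> = {x \<in> carrier_mat (sum_list \<alpha>) (sum_list \<alpha>).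
     \<forall>k<length \<alpha>. \<forall>l<k. \<forall>p\<in>blk \<alpha> k. \<forall>q\<in>blk \<alpha> l. x $$ (p, q) = 0}"

definition nilradical :: "nat list \<Rightarrow> complex mat set" where
  "nilradical \<alpha> = {x \<in> carrier_mat (sum_list \<alpha>) (sum_list \<alpha>).
     \<forall>k<length \<alpha>. \<forall>l\<le>k. \<forall>p\<in>blk \<alpha> k. \<forall>q\<in>blk \<alpha> l. x $$ (p, q) = 0}"

definition parabolic_group :: "nat list \<Rightarrow> complex mat set" where
  "parabolic_group \<alpha> = parabolic \<alpha> \<inter> Units (gl_ring (sum_list \<alpha>))"

text \<open>
  The trace pairing identifies the dual of \<^term>\<open>parabolic \<alpha>\<close> with the quotient of all
  matrices by \<^term>\<open>nilradical \<alpha>\<close>. Its elements are cosets; \<open>cls \<alpha> x\<close> is the coset of \<open>x\<close>.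
\<close>

definition cls :: "nat list \<Rightarrow> complex mat \<Rightarrow> complex mat set" where
  "cls \<alpha> x = (\<lambda>y. x + y) ` nilradical \<alpha>"

text \<open>
  Column vectors are matrices with one column and row vectors are matrices with one row, so that
  \<open>i * j\<close> below is a square matrix.
\<close>

type_synonym quadruple = "complex mat \<times> complex mat set \<times> complex mat \<times> complex mat"

definition C_tilde :: "nat list \<Rightarrow> quadruple set" where
  "C_tilde \<alpha> = (let n = sum_list \<alpha> in
     {(r, cls \<alpha> s, i, j) | r s i j.
        r \<in> parabolic \<alpha> \<and> s \<in> carrier_mat n n \<and> i \<in> carrier_mat n 1 \<and> j \<in> carrier_mat 1 n \<and>
        cls \<alpha> ((r * s - s * r) + 1\<^sub>m n) = cls \<alpha> (- (i * j))})"

text \<open>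
  In the second component \<open>s\<close> runs over the representatives of the given coset \<open>S\<close>; since
  conjugation by \<open>b\<close> preserves \<^term>\<open>nilradical \<alpha>\<close>, they all give the same class.
\<close>

definition P_orbit :: "nat list \<Rightarrow> quadruple \<Rightarrow> quadruple set" where
  "P_orbit \<alpha> = (\<lambda>(r, S, i, j). let G = gl_ring (sum_list \<alpha>) in
     {(b * r * inv\<^bsub>G\<^esub> b, cls \<alpha> (b * s * inv\<^bsub>G\<^esub> b), b * i, j * inv\<^bsub>G\<^esub> b) | b s.
        b \<in> parabolic_group \<alpha> \<and> s \<in> S})"

definition diagonalizable_mat :: "complex mat \<Rightarrow> bool" where
  "diagonalizable_mat A \<longleftrightarrow> (\<exists>D. diagonal_mat D \<and> similar_mat A D)"

text \<open>
  The sign of the off-diagonal entries is forced by the convention \<open>r = diag(-\<rho>)\<close>. For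
  \<open>i\<close> with all entries \<open>-1\<close> and \<open>j\<close> with all entries \<open>1\<close>, the equation defining \<^term>\<open>C_tilde \<alpha>\<close>
  reads \<open>(\<rho> q - \<rho> p) * s $$ (p, q) = 1\<close> at every position \<open>p \<noteq> q\<close> that is not strictly block
  upper triangular. The entry is therefore the inverse of \<open>\<rho> q - \<rho> p\<close>, and
  the familiar \<open>\<rho> p - \<rho> q\<close> belongs to the convention \<open>r = diag(\<rho>)\<close>.
\<close>

definition block_lower_CM :: "nat list \<Rightarrow> (nat \<Rightarrow> complex) \<Rightarrow> (nat \<Rightarrow> complex) \<Rightarrow> complex mat" where
  "block_lower_CM \<alpha> \<rho> \<sigma> = Matrix.mat (sum_list \<alpha>) (sum_list \<alpha>) (\<lambda>(p, q).
     if p = q then \<sigma> p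
     else if q < p \<or> (p < q \<and> in_diag_block \<alpha> p q) then inverse (\<rho> q - \<rho> p)
     else 0)"

definition CM_point :: "nat list \<Rightarrow> (nat \<Rightarrow> complex) \<Rightarrow> (nat \<Rightarrow> complex) \<Rightarrow> quadruple" where
  "CM_point \<alpha> \<rho> \<sigma> = (let n = sum_list \<alpha> in
     (mat_diag n (\<lambda>p. - \<rho> p), cls \<alpha> (block_lower_CM \<alpha> \<rho> \<sigma>),
      Matrix.mat n 1 (\<lambda>_. - 1), Matrix.mat 1 n (\<lambda>_. 1)))"

end

(*
  The eigenprojections of a diagonalizable r in the parabolic subalgebra preserve the flag, so r can be
  diagonalized by an element of P. Once r = diag(d), the defining equation at the positions that are
  not strictly block upper triangular reads (d_p - d_q) s_pq + delta_pq = - i_p j_q. The diagonal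
  entries give i_p j_p = -1, so no i_p or j_p vanishes, and then d_p = d_q is impossible for p \<noteq> q,
  since (p, q) or (q, p) is such a position. Conjugating by diag(j) normalizes i and j, after which
  the equation determines s off the diagonal. The elements of P relating two normal forms are the
  permutation matrices of the Young subgroup.
*)

theory Submission
  imports Defs
begin

text \<open>A matrix that diagonalizes r comes from similarity in GL_n and has no relation to the
  flag; only its spectral projections are canonical enough to lie in the parabolic algebra. An
  eigenbasis adapted to the flag is built from them by exchanging columns inside P, starting at the
  identity. The second obstacle is that s and the defining equation live in a quotient. Read as
  membership of [r,s] + 1 + ij in the nilradical, the equation can be conjugated by P, because the
  nilradical is an ideal of the parabolic algebra; so it may be evaluated entry by entry in the
  frame where r is diagonal. One diagonal rescaling repairs i and j together because i_p j_p = -1,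
  and the diagonal of s, on which the equation puts no condition, supplies the parameters
  sigma.\<close>

section \<open>Blocks of a composition as level sets of a monotone function\<close>

text \<open>With this function, membership in \<open>parabolic\<close>, \<open>nilradical\<close>,
  \<open>in_diag_block\<close> and \<open>young_subgroup\<close> becomes a comparison of two natural
  numbers, and the partial sums bounding the blocks can be forgotten.\<close>

definition block_index :: "nat list \<Rightarrow> nat \<Rightarrow> nat" where
  "block_index \<alpha> p = (LEAST k. p < sum_list (take (Suc k) \<alpha>))"

lemma sum_list_take_mono:
  fixes \<alpha> :: "nat list"
  assumes "k \<le> l"
  shows "sum_list (take k \<alpha>) \<le> sum_list (take l \<alpha>)"
proof -
  have "take l \<alpha> = take k \<alpha> @ take (l - k) (drop k \<alpha>)"
    using assms by (metis le_add_diff_inverse take_add)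
  then show ?thesis by simp
qed

lemma mem_blk_iff:
  assumes p: "p < sum_list \<alpha>"
  shows "p \<in> blk \<alpha> k \<longleftrightarrow> block_index \<alpha> p = k"
proof
  assume "p \<in> blk \<alpha> k"
  then have k: "sum_list (take k \<alpha>) \<le> p" "p < sum_list (take (Suc k) \<alpha>)"
    by (auto simp: blk_def)
  show "block_index \<alpha> p = k"
    unfolding block_index_def
  proof (rule Least_equality)
    fix l assume l: "p < sum_list (take (Suc l) \<alpha>)"
    show "k \<le> l"
    proof (rule ccontr)
      assume "\<not> k \<le> l"
      then have "sum_list (take (Suc l) \<alpha>) \<le> sum_list (take k \<alpha>)"
        by (intro sum_list_take_mono) auto
      with k l show False by linarith
    qed
  qed (fact k)
next
  assume k: "block_index \<alpha> p = k"
  have "p < sum_list (take (Suc (length \<alpha>)) \<alpha>)" using p by simp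
  then have 1: "p < sum_list (take (Suc k) \<alpha>)"
    unfolding k[symmetric] block_index_def by (rule LeastI)
  have "sum_list (take k \<alpha>) \<le> p"
  proof (cases k)
    case (Suc l)
    then have "\<not> p < sum_list (take (Suc l) \<alpha>)"
      using not_less_Least[of l "\<lambda>k. p < sum_list (take (Suc k) \<alpha>)"] k
      unfolding block_index_def by auto
    then show ?thesis using Suc by simp
  qed simp
  with 1 show "p \<in> blk \<alpha> k" by (auto simp: blk_def)
qed

lemma block_index_less:
  assumes p: "p < sum_list \<alpha>"
  shows "block_index \<alpha> p < length \<alpha>"
proof (rule ccontr)
  assume "\<not> ?thesis"
  then have "take (block_index \<alpha> p) \<alpha> = \<alpha>" by simp
  moreover have "p \<in> blk \<alpha> (block_index \<alpha> p)" using mem_blk_iff[OF p] by simp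
  ultimately show False using p by (auto simp: blk_def)
qed

lemma block_index_mono:
  assumes "p \<le> q" "q < sum_list \<alpha>"
  shows "block_index \<alpha> p \<le> block_index \<alpha> q"
proof -
  have "q < sum_list (take (Suc (block_index \<alpha> q)) \<alpha>)"
    using mem_blk_iff[OF assms(2)] by (auto simp: blk_def)
  then show ?thesis
    using assms(1) unfolding block_index_def[of \<alpha> p] by (intro Least_le) simp
qed

lemma blk_subset: "blk \<alpha> k \<subseteq> {..<sum_list \<alpha>}"
proof -
  have "sum_list (take (Suc k) \<alpha>) \<le> sum_list (take (max (Suc k) (length \<alpha>)) \<alpha>)"
    by (rule sum_list_take_mono) simp
  then show ?thesis by (auto simp: blk_def)
qed

lemma mem_blk: "p \<in> blk \<alpha> k \<longleftrightarrow> p < sum_list \<alpha> \<and> block_index \<alpha> p = k"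
  using blk_subset[of \<alpha> k] mem_blk_iff by blast

lemma in_diag_block_iff:
  assumes "p < sum_list \<alpha>" "q < sum_list \<alpha>"
  shows "in_diag_block \<alpha> p q \<longleftrightarrow> block_index \<alpha> p = block_index \<alpha> q"
  using assms block_index_less by (auto simp: in_diag_block_def mem_blk)

lemma parabolic_iff:
  "x \<in> parabolic \<alpha> \<longleftrightarrow> x \<in> carrier_mat (sum_list \<alpha>) (sum_list \<alpha>) \<and>
    (\<forall>p<sum_list \<alpha>. \<forall>q<sum_list \<alpha>. block_index \<alpha> q < block_index \<alpha> p \<longrightarrow> x $$ (p, q) = 0)"
  (is "_ \<longleftrightarrow> ?C \<and> ?Z")
proof -
  have "(\<forall>k<length \<alpha>. \<forall>l<k. \<forall>p\<in>blk \<alpha> k. \<forall>q\<in>blk \<alpha> l. x $$ (p, q) = 0) \<longleftrightarrow> ?Z"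
    using block_index_less by (simp add: Ball_def mem_blk) blast
  then show ?thesis by (simp add: parabolic_def)
qed

lemma nilradical_iff:
  "x \<in> nilradical \<alpha> \<longleftrightarrow> x \<in> carrier_mat (sum_list \<alpha>) (sum_list \<alpha>) \<and>
    (\<forall>p<sum_list \<alpha>. \<forall>q<sum_list \<alpha>. block_index \<alpha> q \<le> block_index \<alpha> p \<longrightarrow> x $$ (p, q) = 0)"
  (is "_ \<longleftrightarrow> ?C \<and> ?Z")
proof -
  have "(\<forall>k<length \<alpha>. \<forall>l\<le>k. \<forall>p\<in>blk \<alpha> k. \<forall>q\<in>blk \<alpha> l. x $$ (p, q) = 0) \<longleftrightarrow> ?Z"
    using block_index_less by (simp add: Ball_def mem_blk) blast
  then show ?thesis by (simp add: nilradical_def)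
qed

lemma young_subgroup_iff:
  "\<pi> \<in> young_subgroup \<alpha> \<longleftrightarrow> \<pi> permutes {..<sum_list \<alpha>} \<and>
    (\<forall>p<sum_list \<alpha>. block_index \<alpha> (\<pi> p) = block_index \<alpha> p)"
proof (cases "\<pi> permutes {..<sum_list \<alpha>}")
  case True
  then have lt: "\<pi> p < sum_list \<alpha>" if "p < sum_list \<alpha>" for p
    using that permutes_in_image by fastforce
  \<comment> \<open>An injective map of a finite block into itself is onto, so only the inclusion
    has to be checked.\<close>
  have "\<pi> ` blk \<alpha> k = blk \<alpha> k \<longleftrightarrow> \<pi> ` blk \<alpha> k \<subseteq> blk \<alpha> k" for k
  proof -
    have "inj_on \<pi> (blk \<alpha> k)" using True permutes_inj_on by blast
    then show ?thesis
      using endo_inj_surj[of "blk \<alpha> k" \<pi>] by (auto simp: blk_def)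
  qed
  then have "(\<forall>k<length \<alpha>. \<pi> ` blk \<alpha> k = blk \<alpha> k) \<longleftrightarrow>
      (\<forall>k<length \<alpha>. \<forall>p\<in>blk \<alpha> k. \<pi> p \<in> blk \<alpha> k)"
    by (simp add: image_subset_iff)
  also have "\<dots> \<longleftrightarrow> (\<forall>p<sum_list \<alpha>. block_index \<alpha> (\<pi> p) = block_index \<alpha> p)"
    using block_index_less lt by (simp add: Ball_def mem_blk) blast
  finally show ?thesis using True by (simp add: young_subgroup_def)
qed (simp add: young_subgroup_def)

section \<open>The parabolic algebra, its nilradical and the cosets\<close>

lemma index_mult_mat_sum:
  assumes "A \<in> carrier_mat m k" "B \<in> carrier_mat k n" "p < m" "q < n"
  shows "(A * B) $$ (p, q) = (\<Sum>u<k. A $$ (p, u) * B $$ (u, q))"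
  using assms by (auto simp: scalar_prod_def lessThan_atLeast0 intro!: sum.cong)

declare index_mult_mat(1) [simp del]

lemma one_mem_parabolic: "1\<^sub>m (sum_list \<alpha>) \<in> parabolic \<alpha>"
  by (auto simp: parabolic_iff)

lemma parabolic_carrier: "x \<in> parabolic \<alpha> \<Longrightarrow> x \<in> carrier_mat (sum_list \<alpha>) (sum_list \<alpha>)"
  by (simp add: parabolic_iff)

lemma nilradical_carrier: "x \<in> nilradical \<alpha> \<Longrightarrow> x \<in> carrier_mat (sum_list \<alpha>) (sum_list \<alpha>)"
  by (simp add: nilradical_iff)

lemma mult_mem_parabolic:
  assumes "x \<in> parabolic \<alpha>" "y \<in> parabolic \<alpha>"
  shows "x * y \<in> parabolic \<alpha>"
  unfolding parabolic_iff
proof (intro conjI allI impI)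
  show "x * y \<in> carrier_mat (sum_list \<alpha>) (sum_list \<alpha>)"
    using assms by (auto simp: parabolic_iff)
  fix p q assume pq: "p < sum_list \<alpha>" "q < sum_list \<alpha>" "block_index \<alpha> q < block_index \<alpha> p"
  have "x $$ (p, u) * y $$ (u, q) = 0" if "u < sum_list \<alpha>" for u
    using assms pq that by (cases "block_index \<alpha> u < block_index \<alpha> p") (auto simp: parabolic_iff)
  then show "(x * y) $$ (p, q) = 0"
    using assms pq by (subst index_mult_mat_sum[of x "sum_list \<alpha>" "sum_list \<alpha>" y "sum_list \<alpha>" p q])
      (auto simp: parabolic_iff intro!: sum.neutral)
qed

text \<open>With its mirror image below, this is the ideal property that lets P act on cosets. In
  every summand one factor vanishes: either u lies in an earlier block than p, or the block of q is
  at most that of u.\<close>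

lemma mult_mem_nilradical_left:
  assumes "x \<in> parabolic \<alpha>" "y \<in> nilradical \<alpha>"
  shows "x * y \<in> nilradical \<alpha>"
  unfolding nilradical_iff
proof (intro conjI allI impI)
  show "x * y \<in> carrier_mat (sum_list \<alpha>) (sum_list \<alpha>)"
    using assms by (auto simp: parabolic_iff nilradical_iff)
  fix p q assume pq: "p < sum_list \<alpha>" "q < sum_list \<alpha>" "block_index \<alpha> q \<le> block_index \<alpha> p"
  have "x $$ (p, u) * y $$ (u, q) = 0" if "u < sum_list \<alpha>" for u
    using assms pq that
    by (cases "block_index \<alpha> u < block_index \<alpha> p") (auto simp: parabolic_iff nilradical_iff)
  then show "(x * y) $$ (p, q) = 0"
    using assms pq
    by (subst index_mult_mat_sum[of x "sum_list \<alpha>" "sum_list \<alpha>" y "sum_list \<alpha>" p q])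
      (auto simp: parabolic_iff nilradical_iff intro!: sum.neutral)
qed

lemma mult_mem_nilradical_right:
  assumes "x \<in> nilradical \<alpha>" "y \<in> parabolic \<alpha>"
  shows "x * y \<in> nilradical \<alpha>"
  unfolding nilradical_iff
proof (intro conjI allI impI)
  show "x * y \<in> carrier_mat (sum_list \<alpha>) (sum_list \<alpha>)"
    using assms by (auto simp: parabolic_iff nilradical_iff)
  fix p q assume pq: "p < sum_list \<alpha>" "q < sum_list \<alpha>" "block_index \<alpha> q \<le> block_index \<alpha> p"
  have "x $$ (p, u) * y $$ (u, q) = 0" if "u < sum_list \<alpha>" for u
    using assms pq that
    by (cases "block_index \<alpha> u \<le> block_index \<alpha> p") (auto simp: parabolic_iff nilradical_iff)
  then show "(x * y) $$ (p, q) = 0"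
    using assms pq
    by (subst index_mult_mat_sum[of x "sum_list \<alpha>" "sum_list \<alpha>" y "sum_list \<alpha>" p q])
      (auto simp: parabolic_iff nilradical_iff intro!: sum.neutral)
qed

lemma mem_cls_iff:
  assumes "x \<in> carrier_mat (sum_list \<alpha>) (sum_list \<alpha>)"
  shows "z \<in> cls \<alpha> x \<longleftrightarrow> z \<in> carrier_mat (sum_list \<alpha>) (sum_list \<alpha>) \<and>
    (\<forall>p<sum_list \<alpha>. \<forall>q<sum_list \<alpha>. block_index \<alpha> q \<le> block_index \<alpha> p \<longrightarrow> z $$ (p, q) = x $$ (p, q))"
proof
  assume "z \<in> cls \<alpha> x"
  then show "z \<in> carrier_mat (sum_list \<alpha>) (sum_list \<alpha>) \<and>
    (\<forall>p<sum_list \<alpha>. \<forall>q<sum_list \<alpha>. block_index \<alpha> q \<le> block_index \<alpha> p \<longrightarrow> z $$ (p, q) = x $$ (p, q))"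
    using assms by (auto simp: cls_def nilradical_iff)
next
  assume z: "z \<in> carrier_mat (sum_list \<alpha>) (sum_list \<alpha>) \<and>
    (\<forall>p<sum_list \<alpha>. \<forall>q<sum_list \<alpha>. block_index \<alpha> q \<le> block_index \<alpha> p \<longrightarrow> z $$ (p, q) = x $$ (p, q))"
  have "z = x + (z - x)" using z assms by (intro eq_matI) auto
  moreover have "z - x \<in> nilradical \<alpha>"
    using z assms by (auto simp: nilradical_iff)
  ultimately show "z \<in> cls \<alpha> x" unfolding cls_def by blast
qed

lemma cls_eq_iff:
  assumes "x \<in> carrier_mat (sum_list \<alpha>) (sum_list \<alpha>)" "y \<in> carrier_mat (sum_list \<alpha>) (sum_list \<alpha>)"
  shows "cls \<alpha> x = cls \<alpha> y \<longleftrightarrow>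
    (\<forall>p<sum_list \<alpha>. \<forall>q<sum_list \<alpha>. block_index \<alpha> q \<le> block_index \<alpha> p \<longrightarrow> x $$ (p, q) = y $$ (p, q))"
    (is "_ \<longleftrightarrow> ?E")
proof
  assume "cls \<alpha> x = cls \<alpha> y"
  then have "x \<in> cls \<alpha> y" using assms mem_cls_iff by blast
  then show ?E using assms mem_cls_iff by blast
next
  assume ?E
  then show "cls \<alpha> x = cls \<alpha> y" using assms by (auto simp: mem_cls_iff)
qed

section \<open>Spectral projections of a diagonalizable element\<close>

text \<open>This is the independence of eigenvectors for distinct eigenvalues, applied modulo a step
  of the flag. The coordinates p with \<open>k < f p\<close> describe the quotient by the step of
  level k, and r acts there because it is triangular with respect to f. The induction replaces the
  family by its image under r - \<mu>, so y has to be arbitrary.\<close>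

lemma eigencomponents_vanish:
  fixes r :: "complex mat" and y :: "complex \<Rightarrow> nat \<Rightarrow> complex" and f :: "nat \<Rightarrow> nat"
  assumes "finite F"
    and "\<And>p q. p < n \<Longrightarrow> q < n \<Longrightarrow> f q < f p \<Longrightarrow> r $$ (p, q) = 0"
    and "\<And>\<nu> p. p < n \<Longrightarrow> (\<Sum>q<n. r $$ (p, q) * y \<nu> q) = \<nu> * y \<nu> p"
    and "\<And>p. p < n \<Longrightarrow> k < f p \<Longrightarrow> (\<Sum>\<nu>\<in>F. y \<nu> p) = 0"
    and "p < n" "k < f p" "\<nu> \<in> F"
  shows "y \<nu> p = 0"
  using assms
proof (induction F arbitrary: y p \<nu> rule: finite_induct)
  case (insert \<mu> F)
  note r = insert.prems(1) and eig = insert.prems(2) and zero = insert.prems(3)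
  \<comment> \<open>Applying r - \<mu> kills the component of \<mu> and multiplies the one of \<nu>
    by the nonzero factor \<nu> - \<mu>.\<close>
  have step: "(\<Sum>\<nu>\<in>F. (\<nu> - \<mu>) * y \<nu> p) = 0" if p: "p < n" "k < f p" for p
  proof -
    have "(\<Sum>\<nu>\<in>insert \<mu> F. \<nu> * y \<nu> p) = (\<Sum>\<nu>\<in>insert \<mu> F. \<Sum>q<n. r $$ (p, q) * y \<nu> q)"
      using eig p by simp
    also have "\<dots> = (\<Sum>q<n. r $$ (p, q) * (\<Sum>\<nu>\<in>insert \<mu> F. y \<nu> q))"
      by (subst sum.swap) (simp only: sum_distrib_left)
    \<comment> \<open>Either \<open>f q < f p\<close>, and r vanishes at (p, q), or
      \<open>k < f p \<le> f q\<close>, and the inner sum vanishes by hypothesis.\<close>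
    also have "\<dots> = 0"
    proof (intro sum.neutral ballI)
      fix q assume q: "q \<in> {..<n}"
      show "r $$ (p, q) * (\<Sum>\<nu>\<in>insert \<mu> F. y \<nu> q) = 0"
        using r[of p q] zero[of q] p q by (cases "f q < f p") auto
    qed
    finally have "(\<Sum>\<nu>\<in>insert \<mu> F. \<nu> * y \<nu> p) - \<mu> * (\<Sum>\<nu>\<in>insert \<mu> F. y \<nu> p) = 0"
      using zero[OF p] by simp
    then have "(\<Sum>\<nu>\<in>insert \<mu> F. (\<nu> - \<mu>) * y \<nu> p) = 0"
      by (simp only: sum_distrib_left sum_subtractf[symmetric] left_diff_distrib)
    then show ?thesis using insert.hyps by simp
  qed
  have F: "y \<nu> p = 0" if "\<nu> \<in> F" "p < n" "k < f p" for \<nu> p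
  proof -
    have "(\<nu> - \<mu>) * y \<nu> p = 0"
    proof (rule insert.IH[of "\<lambda>\<nu> p. (\<nu> - \<mu>) * y \<nu> p"])
      fix \<nu> p assume p: "p < n"
      have "(\<Sum>q<n. r $$ (p, q) * ((\<nu> - \<mu>) * y \<nu> q)) = (\<nu> - \<mu>) * (\<Sum>q<n. r $$ (p, q) * y \<nu> q)"
        by (simp only: sum_distrib_left mult.left_commute)
      then show "(\<Sum>q<n. r $$ (p, q) * ((\<nu> - \<mu>) * y \<nu> q)) = \<nu> * ((\<nu> - \<mu>) * y \<nu> p)"
        by (simp add: eig[OF p])
    qed (use that step r in auto)
    then show ?thesis using insert.hyps that by auto
  qed
  show ?case
  proof (cases "\<nu> = \<mu>")
    case True
    then show ?thesis
      using zero[OF insert.prems(4,5)] insert.hyps F insert.prems by simp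
  next
    case False
    then show ?thesis using F insert.prems by simp
  qed
qed simp

text \<open>For any diagonalization r = g D h, \<open>Pr \<nu>\<close> is g times the indicator
  matrix of the eigenvalue \<nu> times h. For fixed q, the columns q of all \<open>Pr \<nu>\<close>
  are eigencomponents of the unit vector e_q. That vector lies in the flag step of its own block,
  hence so do its components, although the columns of g themselves may violate the flag.\<close>

lemma parabolic_eigenprojections:
  assumes r: "r \<in> parabolic \<alpha>" and diag: "diagonalizable_mat r"
  obtains F :: "complex set" and Pr where "finite F" "\<And>\<nu>. Pr \<nu> \<in> parabolic \<alpha>"
    "\<And>\<nu> p q. p < sum_list \<alpha> \<Longrightarrow> q < sum_list \<alpha> \<Longrightarrow> (r * Pr \<nu>) $$ (p, q) = \<nu> * Pr \<nu> $$ (p, q)"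
    "\<And>p q. p < sum_list \<alpha> \<Longrightarrow> q < sum_list \<alpha> \<Longrightarrow> (\<Sum>\<nu>\<in>F. Pr \<nu> $$ (p, q)) = (if p = q then 1 else 0)"
proof -
  define n where "n = sum_list \<alpha>"
  have rc: "r \<in> carrier_mat n n" using r by (simp add: parabolic_iff n_def)
  obtain D where D: "diagonal_mat D" "similar_mat r D"
    using diag by (auto simp: diagonalizable_mat_def)
  then obtain g h where "similar_mat_wit r D g h" by (auto simp: similar_mat_def)
  from similar_mat_witD2[OF rc this]
  have gh: "g * h = 1\<^sub>m n" "h * g = 1\<^sub>m n" "r = g * D * h"
    and c: "D \<in> carrier_mat n n" "g \<in> carrier_mat n n" "h \<in> carrier_mat n n" by auto
  define d where "d q = D $$ (q, q)" for q
  have rg: "(\<Sum>u<n. r $$ (p, u) * g $$ (u, q)) = d q * g $$ (p, q)" if "p < n" "q < n" for p q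
  proof -
    have "r * g = g * D * (h * g)"
      using c by (simp add: gh(3) assoc_mult_mat[of _ n n _ n _ n])
    then have "r * g = g * D" using c gh(2) by simp
    then have "(r * g) $$ (p, q) = (\<Sum>u<n. g $$ (p, u) * D $$ (u, q))"
      using c that by (simp add: index_mult_mat_sum[of g n n D n])
    also have "\<dots> = (\<Sum>u<n. if u = q then g $$ (p, q) * d q else 0)"
      using D(1) c that by (intro sum.cong) (auto simp: diagonal_mat_def d_def)
    finally show ?thesis
      using c rc that by (simp add: index_mult_mat_sum[of r n n g n])
  qed
  define F where "F = d ` {..<n}"
  define Pr where
    "Pr \<nu> = Matrix.mat n n (\<lambda>(p, q). \<Sum>u<n. if d u = \<nu> then g $$ (p, u) * h $$ (u, q) else 0)" for \<nu>
  have eig: "(\<Sum>u<n. r $$ (p, u) * Pr \<nu> $$ (u, q)) = \<nu> * Pr \<nu> $$ (p, q)"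
    if pq: "p < n" "q < n" for p q \<nu>
  proof -
    have "(\<Sum>u<n. r $$ (p, u) * Pr \<nu> $$ (u, q)) =
        (\<Sum>u<n. \<Sum>v<n. if d v = \<nu> then r $$ (p, u) * g $$ (u, v) * h $$ (v, q) else 0)"
      using pq by (simp add: Pr_def sum_distrib_left if_distrib mult.assoc cong: if_cong)
    also have "\<dots> = (\<Sum>v<n. if d v = \<nu> then (\<Sum>u<n. r $$ (p, u) * g $$ (u, v)) * h $$ (v, q) else 0)"
      by (subst sum.swap) (auto simp: sum_distrib_right intro!: sum.cong)
    also have "\<dots> = (\<Sum>v<n. if d v = \<nu> then \<nu> * (g $$ (p, v) * h $$ (v, q)) else 0)"
      using pq rg by (auto intro!: sum.cong)
    also have "\<dots> = \<nu> * Pr \<nu> $$ (p, q)"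
      using pq by (simp add: Pr_def sum_distrib_left if_distrib cong: if_cong)
    finally show ?thesis .
  qed
  have one: "(\<Sum>\<nu>\<in>F. Pr \<nu> $$ (p, q)) = (if p = q then 1 else 0)" if pq: "p < n" "q < n" for p q
  proof -
    have "(\<Sum>\<nu>\<in>F. Pr \<nu> $$ (p, q)) = (\<Sum>u<n. \<Sum>\<nu>\<in>F. if d u = \<nu> then g $$ (p, u) * h $$ (u, q) else 0)"
      using pq by (simp add: Pr_def sum.swap[of _ F])
    also have "\<dots> = (\<Sum>u<n. g $$ (p, u) * h $$ (u, q))"
      by (intro sum.cong) (auto simp: F_def)
    also have "\<dots> = (g * h) $$ (p, q)"
      using c pq by (simp add: index_mult_mat_sum[of g n n h n])
    finally show ?thesis using gh(1) pq by simp
  qed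
  have "Pr \<nu> $$ (p, q) = 0" if "p < n" "q < n" "block_index \<alpha> q < block_index \<alpha> p" for p q \<nu>
  proof (cases "\<nu> \<in> F")
    case True
    show ?thesis
    proof (rule eigencomponents_vanish[where y = "\<lambda>\<nu> p. Pr \<nu> $$ (p, q)" and f = "block_index \<alpha>"
          and n = n and k = "block_index \<alpha> q" and r = r and F = F])
      show "finite F" by (simp add: F_def)
    qed (use that True eig one r in \<open>auto simp: parabolic_iff n_def\<close>)
  next
    case False
    then have "d u \<noteq> \<nu>" if "u < n" for u using that by (auto simp: F_def)
    then show ?thesis using that by (simp add: Pr_def)
  qed
  then have Pr: "Pr \<nu> \<in> parabolic \<alpha>" for \<nu>
    by (simp add: parabolic_iff n_def[symmetric]) (simp add: Pr_def)
  show ?thesis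
  proof (rule that[of F Pr])
    show "finite F" by (simp add: F_def)
    show "(r * Pr \<nu>) $$ (p, q) = \<nu> * Pr \<nu> $$ (p, q)"
      if "p < sum_list \<alpha>" "q < sum_list \<alpha>" for \<nu> p q
      using eig[of p q \<nu>] that rc parabolic_carrier[OF Pr[of \<nu>]]
      by (simp add: index_mult_mat_sum[of r n n "Pr \<nu>" n] n_def)
  qed (use Pr one in \<open>simp_all add: n_def\<close>)
qed

section \<open>Diagonalization inside P by column exchange\<close>

definition replace_col :: "nat \<Rightarrow> nat \<Rightarrow> (nat \<Rightarrow> complex) \<Rightarrow> complex mat" where
  "replace_col n m w = Matrix.mat n n (\<lambda>(p, q). if q = m then w p else if p = q then 1 else 0)"

lemma replace_col_carrier [simp]: "replace_col n m w \<in> carrier_mat n n"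
  by (simp add: replace_col_def)

lemma index_mult_replace_col:
  assumes "A \<in> carrier_mat n n" "p < n" "q < n"
  shows "(A * replace_col n m w) $$ (p, q) =
    (if q = m then \<Sum>u<n. A $$ (p, u) * w u else A $$ (p, q))"
proof -
  have "(A * replace_col n m w) $$ (p, q) = (\<Sum>u<n. A $$ (p, u) * replace_col n m w $$ (u, q))"
    using assms by (intro index_mult_mat_sum) auto
  also have "\<dots> = (\<Sum>u<n. if q = m then A $$ (p, u) * w u else if u = q then A $$ (p, q) else 0)"
    using assms by (intro sum.cong) (auto simp: replace_col_def)
  finally show ?thesis using assms by (cases "q = m") auto
qed

text \<open>The new column m solves w = \<Sum> w_p e_p for e_m: it holds the coordinates of e_m in
  the basis in which w has taken the place of e_m.\<close>

definition replace_col_inv :: "nat \<Rightarrow> nat \<Rightarrow> (nat \<Rightarrow> complex) \<Rightarrow> complex mat" where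
  "replace_col_inv n m w = replace_col n m (\<lambda>p. if p = m then 1 / w m else - w p / w m)"

lemma replace_col_inverse:
  assumes "m < n" "w m \<noteq> 0"
  shows "replace_col n m w * replace_col_inv n m w = 1\<^sub>m n"
proof (rule eq_matI)
  fix p q assume pq: "p < dim_row (1\<^sub>m n :: complex mat)" "q < dim_col (1\<^sub>m n :: complex mat)"
  let ?v = "\<lambda>p. if p = m then 1 / w m else - w p / w m"
  have "(\<Sum>u<n. replace_col n m w $$ (p, u) * ?v u) =
      (\<Sum>u<n. (if u = m then w p / w m else 0) + (if u = p then (if p = m then 0 else ?v p) else 0))"
    using pq by (intro sum.cong) (auto simp: replace_col_def)
  also have "\<dots> = w p / w m + (if p = m then 0 else ?v p)"
    using pq assms by (simp add: sum.distrib)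
  finally show "(replace_col n m w * replace_col_inv n m w) $$ (p, q) = 1\<^sub>m n $$ (p, q)"
    using pq assms unfolding replace_col_inv_def
    by (subst index_mult_replace_col) (auto simp: replace_col_def)
qed (auto simp: replace_col_def replace_col_inv_def)

lemma replace_col_mem_parabolic:
  assumes "m < sum_list \<alpha>"
    "\<And>p. p < sum_list \<alpha> \<Longrightarrow> block_index \<alpha> m < block_index \<alpha> p \<Longrightarrow> w p = 0"
  shows "replace_col (sum_list \<alpha>) m w \<in> parabolic \<alpha>"
  using assms by (auto simp: parabolic_iff replace_col_def)

text \<open>
  Steinitz exchange inside the parabolic: starting from the identity, the columns of \<open>B\<close> are replaced
  one after another by eigenvectors. The new column is an eigencomponent of the old one, so it stays in the
  same step of the flag; as the components sum to the old column, one of them has a nonzero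
  coordinate along it.
\<close>

lemma parabolic_diagonalization:
  assumes r: "r \<in> parabolic \<alpha>" and diag: "diagonalizable_mat r"
  obtains B C d where "B \<in> parabolic \<alpha>" "C \<in> parabolic \<alpha>"
    "B * C = 1\<^sub>m (sum_list \<alpha>)" "C * B = 1\<^sub>m (sum_list \<alpha>)"
    "C * r * B = mat_diag (sum_list \<alpha>) d"
proof -
  define n where "n = sum_list \<alpha>"
  have rc: "r \<in> carrier_mat n n" using r by (simp add: parabolic_iff n_def)
  obtain F Pr where F: "finite F" and Pr: "\<And>\<nu>. Pr \<nu> \<in> parabolic \<alpha>"
    and eig: "\<And>\<nu> p q. p < n \<Longrightarrow> q < n \<Longrightarrow> (r * Pr \<nu>) $$ (p, q) = \<nu> * Pr \<nu> $$ (p, q)"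
    and one: "\<And>p q. p < n \<Longrightarrow> q < n \<Longrightarrow> (\<Sum>\<nu>\<in>F. Pr \<nu> $$ (p, q)) = (if p = q then 1 else 0)"
    using parabolic_eigenprojections[OF r diag] unfolding n_def by metis
  have Prc: "Pr \<nu> \<in> carrier_mat n n" for \<nu> using Pr by (simp add: parabolic_iff n_def)
  have "\<exists>B C d. B \<in> parabolic \<alpha> \<and> C \<in> parabolic \<alpha> \<and> B * C = 1\<^sub>m n \<and> C * B = 1\<^sub>m n \<and>
      (\<forall>q<m. \<forall>p<n. (r * B) $$ (p, q) = d q * B $$ (p, q))" if "m \<le> n" for m
    using that
  proof (induction m)
    case 0
    show ?case
      using one_mem_parabolic[of \<alpha>] by (intro exI[of _ "1\<^sub>m n"]) (auto simp: n_def)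
  next
    case (Suc m)
    then obtain B C d where B: "B \<in> parabolic \<alpha>" and C: "C \<in> parabolic \<alpha>"
      and BC: "B * C = 1\<^sub>m n" and CB: "C * B = 1\<^sub>m n"
      and d: "\<forall>q<m. \<forall>p<n. (r * B) $$ (p, q) = d q * B $$ (p, q)"
      by (meson Suc_leD)
    have m: "m < n" using Suc.prems by simp
    have c: "B \<in> carrier_mat n n" "C \<in> carrier_mat n n"
      using B C by (simp_all add: parabolic_iff n_def)
    \<comment> \<open>Since C inverts B, column m of \<open>W \<nu>\<close> lists the coordinates of
      the \<nu>-component of column m of B with respect to the columns of B. Its entry at (m, m) is
      the pivot of the exchange.\<close>
    define W where "W \<nu> = C * (Pr \<nu> * B)" for \<nu>
    have W: "W \<nu> \<in> parabolic \<alpha>" for \<nu>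
      unfolding W_def using B C Pr by (intro mult_mem_parabolic)
    have Wc: "W \<nu> \<in> carrier_mat n n" for \<nu> using W by (simp add: parabolic_iff n_def)
    have "(\<Sum>\<nu>\<in>F. W \<nu> $$ (m, m)) = (\<Sum>\<nu>\<in>F. \<Sum>u<n. C $$ (m, u) * (\<Sum>v<n. Pr \<nu> $$ (u, v) * B $$ (v, m)))"
    proof (rule sum.cong)
      fix \<nu>
      have "W \<nu> $$ (m, m) = (\<Sum>u<n. C $$ (m, u) * (Pr \<nu> * B) $$ (u, m))"
        unfolding W_def using c Prc[of \<nu>] m
        by (intro index_mult_mat_sum) auto
      also have "\<dots> = (\<Sum>u<n. C $$ (m, u) * (\<Sum>v<n. Pr \<nu> $$ (u, v) * B $$ (v, m)))"
        using c Prc[of \<nu>] m by (intro sum.cong) (auto simp: index_mult_mat_sum[of "Pr \<nu>" n n B n])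
      finally show "W \<nu> $$ (m, m) = (\<Sum>u<n. C $$ (m, u) * (\<Sum>v<n. Pr \<nu> $$ (u, v) * B $$ (v, m)))" .
    qed simp
    also have "\<dots> = (\<Sum>u<n. C $$ (m, u) * (\<Sum>v<n. (\<Sum>\<nu>\<in>F. Pr \<nu> $$ (u, v)) * B $$ (v, m)))"
      by (simp add: sum_distrib_left sum_distrib_right sum.swap[of _ F])
    also have "\<dots> = (\<Sum>u<n. C $$ (m, u) * (\<Sum>v<n. if u = v then B $$ (u, m) else 0))"
      using one by (intro sum.cong arg_cong2[where f = "(*)"]) auto
    also have "\<dots> = (\<Sum>u<n. C $$ (m, u) * B $$ (u, m))" by simp
    also have "\<dots> = (C * B) $$ (m, m)"
      using c m by (simp add: index_mult_mat_sum[of C n n B n])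
    finally have "(\<Sum>\<nu>\<in>F. W \<nu> $$ (m, m)) = 1" using CB m by simp
    then obtain \<nu> where w: "W \<nu> $$ (m, m) \<noteq> 0" by (metis sum.neutral zero_neq_one)
    define w where "w p = W \<nu> $$ (p, m)" for p
    define E where "E = replace_col n m w"
    define E' where "E' = replace_col_inv n m w"
    have wz: "w p = 0" if "p < sum_list \<alpha>" "block_index \<alpha> m < block_index \<alpha> p" for p
      using W that m by (auto simp: w_def parabolic_iff n_def)
    have EP: "E \<in> parabolic \<alpha>" "E' \<in> parabolic \<alpha>"
      unfolding E_def E'_def replace_col_inv_def n_def
      using m wz by (auto intro!: replace_col_mem_parabolic simp: n_def)
    then have Ec: "E \<in> carrier_mat n n" "E' \<in> carrier_mat n n"
      by (simp_all add: parabolic_iff n_def)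
    have EE: "E * E' = 1\<^sub>m n"
      unfolding E_def E'_def using m w by (intro replace_col_inverse) (auto simp: w_def)
    have "B * W \<nu> = B * C * (Pr \<nu> * B)"
      unfolding W_def using c Prc[of \<nu>] by (simp add: assoc_mult_mat[of _ n n _ n _ n])
    then have BW: "B * W \<nu> = Pr \<nu> * B" using BC c Prc[of \<nu>] by simp
    have col: "(A * W \<nu>) $$ (p, m) = (\<Sum>u<n. A $$ (p, u) * w u)" if "A \<in> carrier_mat n n" "p < n" for A p
      unfolding w_def using that Wc m by (intro index_mult_mat_sum) auto
    have "B * E * (E' * C) = B * (E * E') * C"
      using c Ec by (simp add: assoc_mult_mat[of _ n n _ n _ n])
    then have 1: "B * E * (E' * C) = 1\<^sub>m n" using EE BC c by simp
    have 2: "E' * C * (B * E) = 1\<^sub>m n"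
      by (rule mat_mult_left_right_inverse[OF _ _ 1]) (use c Ec in auto)
    have "(r * (B * E)) $$ (p, q) = (if q = m then \<nu> else d q) * (B * E) $$ (p, q)"
      if q: "q < Suc m" and p: "p < n" for p q
    proof -
      have rBE: "r * (B * E) = r * B * E" using rc c Ec by (simp add: assoc_mult_mat[of _ n n _ n _ n])
      show ?thesis
      proof (cases "q = m")
        case True
        \<comment> \<open>The exchanged column of \<open>B * E\<close> is column m of
          \<open>B * W \<nu> = Pr \<nu> * B\<close>, hence an eigenvector for \<nu>.\<close>
        have "(r * B * E) $$ (p, m) = (r * B * W \<nu>) $$ (p, m)"
          using rc c p m by (simp add: E_def index_mult_replace_col[of _ n] col)
        also have "r * B * W \<nu> = r * Pr \<nu> * B"
          using rc c Wc Prc[of \<nu>] BW by (simp add: assoc_mult_mat[of _ n n _ n _ n])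
        also have "(r * Pr \<nu> * B) $$ (p, m) = (\<Sum>u<n. (r * Pr \<nu>) $$ (p, u) * B $$ (u, m))"
          using rc c Prc[of \<nu>] p m by (intro index_mult_mat_sum) auto
        also have "\<dots> = \<nu> * (\<Sum>u<n. Pr \<nu> $$ (p, u) * B $$ (u, m))"
          using eig p by (simp add: sum_distrib_left mult.assoc)
        also have "(\<Sum>u<n. Pr \<nu> $$ (p, u) * B $$ (u, m)) = (B * W \<nu>) $$ (p, m)"
          unfolding BW using c Prc[of \<nu>] p m by (simp add: index_mult_mat_sum[of _ n n B n])
        also have "\<dots> = (B * E) $$ (p, m)"
          using c p m by (simp add: E_def index_mult_replace_col[of _ n] col)
        finally show ?thesis using True rBE by simp
      next
        case False
        then show ?thesis
          using rBE d rc c p q m by (simp add: E_def index_mult_replace_col[of _ n])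
      qed
    qed
    then show ?case
      using 1 2 mult_mem_parabolic[OF B EP(1)] mult_mem_parabolic[OF EP(2) C]
      by (intro exI[of _ "B * E"] exI[of _ "E' * C"] exI[of _ "\<lambda>q. if q = m then \<nu> else d q"]
          conjI allI impI)
  qed
  from this[of n] obtain B C d where B: "B \<in> parabolic \<alpha>" and C: "C \<in> parabolic \<alpha>"
    and BC: "B * C = 1\<^sub>m n" and CB: "C * B = 1\<^sub>m n"
    and d: "\<forall>q<n. \<forall>p<n. (r * B) $$ (p, q) = d q * B $$ (p, q)"
    by blast
  have c: "B \<in> carrier_mat n n" "C \<in> carrier_mat n n"
    using B C by (simp_all add: parabolic_iff n_def)
  have "r * B = B * mat_diag n d"
    using rc c d by (intro eq_matI) (auto simp: mat_diag_mult_right[of _ n])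
  then have "C * r * B = C * B * mat_diag n d"
    using rc c by (simp add: assoc_mult_mat[of _ n n _ n _ n])
  then have "C * r * B = mat_diag n d" using CB left_mult_one_mat[OF mat_diag_dim] by simp
  then show ?thesis using that B C BC CB by (simp add: n_def)
qed

section \<open>The action of P and equivariance of the defining equation\<close>

lemma inv_gl_ring:
  assumes "b \<in> carrier_mat n n" "b' \<in> carrier_mat n n" "b * b' = 1\<^sub>m n" "b' * b = 1\<^sub>m n"
  shows "b \<in> Units (gl_ring n)" "inv\<^bsub>gl_ring n\<^esub> b = b'"
proof -
  interpret ring "gl_ring n" by (rule ring_mat)
  show "b \<in> Units (gl_ring n)"
    using assms by (auto simp: Units_def ring_mat_simps)
  show "inv\<^bsub>gl_ring n\<^esub> b = b'"
    using assms by (intro inv_char) (auto simp: ring_mat_simps)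
qed

text \<open>Trades the inverse in the matrix ring for an explicit two-sided inverse
  \<open>b'\<close>, so that orbits can be handled by matrix identities alone.\<close>

lemma P_orbit_iff:
  "(r', S', i', j') \<in> P_orbit \<alpha> (r, S, i, j) \<longleftrightarrow>
    (\<exists>b b' s. b \<in> parabolic \<alpha> \<and> b' \<in> carrier_mat (sum_list \<alpha>) (sum_list \<alpha>) \<and>
      b * b' = 1\<^sub>m (sum_list \<alpha>) \<and> b' * b = 1\<^sub>m (sum_list \<alpha>) \<and> s \<in> S \<and>
      r' = b * r * b' \<and> S' = cls \<alpha> (b * s * b') \<and> i' = b * i \<and> j' = j * b')"
    (is "?L \<longleftrightarrow> ?R")
proof
  assume ?L
  then obtain b s where b: "b \<in> parabolic \<alpha>" "b \<in> Units (gl_ring (sum_list \<alpha>))" and s: "s \<in> S"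
    and eq: "r' = b * r * inv\<^bsub>gl_ring (sum_list \<alpha>)\<^esub> b"
      "S' = cls \<alpha> (b * s * inv\<^bsub>gl_ring (sum_list \<alpha>)\<^esub> b)"
      "i' = b * i" "j' = j * inv\<^bsub>gl_ring (sum_list \<alpha>)\<^esub> b"
    by (auto simp: P_orbit_def parabolic_group_def Let_def)
  obtain b' where b': "b' \<in> carrier_mat (sum_list \<alpha>) (sum_list \<alpha>)"
    "b * b' = 1\<^sub>m (sum_list \<alpha>)" "b' * b = 1\<^sub>m (sum_list \<alpha>)"
    using b(2) by (auto simp: Units_def ring_mat_simps)
  then show ?R
    using b s eq inv_gl_ring(2)[OF parabolic_carrier[OF b(1)] b'] by metis
next
  assume ?R
  then obtain b b' s where b: "b \<in> parabolic \<alpha>"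
    and b': "b' \<in> carrier_mat (sum_list \<alpha>) (sum_list \<alpha>)"
      "b * b' = 1\<^sub>m (sum_list \<alpha>)" "b' * b = 1\<^sub>m (sum_list \<alpha>)"
    and s: "s \<in> S"
    and eq: "r' = b * r * b'" "S' = cls \<alpha> (b * s * b')" "i' = b * i" "j' = j * b'"
    by blast
  note inv = inv_gl_ring[OF parabolic_carrier[OF b] b']
  show ?L
    unfolding P_orbit_def parabolic_group_def Let_def prod.case mem_Collect_eq
    by (intro exI[of _ b] exI[of _ s]) (use b inv(1) s in \<open>simp add: eq inv(2)\<close>)
qed

lemma conjugate_mult:
  fixes b :: "'a :: semiring_1 mat"
  assumes "b \<in> carrier_mat n n" "b' \<in> carrier_mat n n" "b' * b = 1\<^sub>m n"
    "x \<in> carrier_mat n n" "y \<in> carrier_mat n n"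
  shows "b * (x * y) * b' = (b * x * b') * (b * y * b')"
proof -
  have "(b * x * b') * (b * y * b') = b * x * (b' * b) * y * b'"
    using assms(1,2,4,5) by (simp add: assoc_mult_mat[of _ n n _ n _ n])
  then show ?thesis using assms by (simp add: assoc_mult_mat[of _ n n _ n _ n])
qed

text \<open>Equivariance of the moment map. Combined with the stability of the nilradical under
  conjugation by P, it carries the defining equation to the frame where r is diagonal.\<close>

lemma moment_map_conjugate:
  fixes b :: "'a :: ring_1 mat"
  assumes b: "b \<in> carrier_mat n n" "b' \<in> carrier_mat n n" "b * b' = 1\<^sub>m n" "b' * b = 1\<^sub>m n"
    and r: "r \<in> carrier_mat n n" and s: "s \<in> carrier_mat n n"
    and i: "i \<in> carrier_mat n 1" and j: "j \<in> carrier_mat 1 n"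
  shows "b * (r * s - s * r + 1\<^sub>m n + i * j) * b' =
    (b * r * b') * (b * s * b') - (b * s * b') * (b * r * b') + 1\<^sub>m n + (b * i) * (j * b')"
proof -
  have ij: "b * (i * j) * b' = (b * i) * (j * b')"
    using b i j by (simp add: assoc_mult_mat[of _ n n _ 1 _ n] assoc_mult_mat[of _ n 1 _ n _ n]
      assoc_mult_mat[of _ n n _ n _ n])
  have "b * (x - y + z + w) * b' = b * x * b' - b * y * b' + b * z * b' + b * w * b'"
    if "x \<in> carrier_mat n n" "y \<in> carrier_mat n n" "z \<in> carrier_mat n n" "w \<in> carrier_mat n n"
    for x y z w
    using b(1,2) that minus_carrier_mat[OF that(2), of x]
      minus_carrier_mat[OF mult_carrier_mat[OF b(1) that(2)], of "b * x"]
      minus_carrier_mat[of "b * (y * b')" n n "b * (x * b')"]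
    by (simp add: add_mult_distrib_mat[of _ n n _ _ n] mult_add_distrib_mat[of _ n n _ n]
      minus_mult_distrib_mat[of _ n n _ _ n] mult_minus_distrib_mat[of _ n n _ n])
  from this[of "r * s" "s * r" "1\<^sub>m n" "i * j"]
  have "b * (r * s - s * r + 1\<^sub>m n + i * j) * b' =
      b * (r * s) * b' - b * (s * r) * b' + b * 1\<^sub>m n * b' + b * (i * j) * b'"
    using r s i j by (simp del: One_nat_def)
  then show ?thesis
    using b conjugate_mult[OF b(1,2,4) r s] conjugate_mult[OF b(1,2,4) s r] ij by simp
qed

lemma cls_conjugate:
  assumes b: "b \<in> parabolic \<alpha>" "b' \<in> parabolic \<alpha>"
    and s: "s \<in> carrier_mat (sum_list \<alpha>) (sum_list \<alpha>)" and x: "x \<in> cls \<alpha> s"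
  shows "cls \<alpha> (b * x * b') = cls \<alpha> (b * s * b')"
proof -
  obtain u where u: "u \<in> nilradical \<alpha>" and xu: "x = s + u" using x by (auto simp: cls_def)
  note c = parabolic_carrier[OF b(1)] parabolic_carrier[OF b(2)] nilradical_carrier[OF u]
  have "b * u * b' \<in> nilradical \<alpha>"
    using b u by (intro mult_mem_nilradical_left mult_mem_nilradical_right)
  moreover have "b * x * b' = b * s * b' + b * u * b'"
    unfolding xu using c s
    by (simp add: add_mult_distrib_mat[of _ "sum_list \<alpha>" "sum_list \<alpha>"]
      mult_add_distrib_mat[of _ "sum_list \<alpha>" "sum_list \<alpha>"])
  ultimately show ?thesis
    using c s xu by (subst cls_eq_iff) (auto simp: nilradical_iff)
qed

section \<open>The Calogero-Moser normal form\<close>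

lemma block_lower_CM_carrier [simp]:
  "block_lower_CM \<alpha> \<rho> \<sigma> \<in> carrier_mat (sum_list \<alpha>) (sum_list \<alpha>)"
  by (simp add: block_lower_CM_def)

text \<open>At such a position with p < q, monotonicity forces both indices into one block, so the
  cases of the definition merge. Its zero entries sit at strictly block upper triangular positions,
  which the coset does not see.\<close>

lemma block_lower_CM_index:
  assumes "p < sum_list \<alpha>" "q < sum_list \<alpha>" "block_index \<alpha> q \<le> block_index \<alpha> p"
  shows "block_lower_CM \<alpha> \<rho> \<sigma> $$ (p, q) = (if p = q then \<sigma> p else inverse (\<rho> q - \<rho> p))"
  using assms block_index_mono[of p q \<alpha>] by (auto simp: block_lower_CM_def in_diag_block_iff)

lemma mat_diag_index:
  "p < n \<Longrightarrow> q < n \<Longrightarrow> mat_diag n d $$ (p, q) = (if p = q then d p else 0)"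
  by (auto simp: mat_diag_def)

lemma mat_diag_conjugate_index:
  assumes "x \<in> carrier_mat n n" "p < n" "q < n"
  shows "(mat_diag n t * x * mat_diag n u) $$ (p, q) = t p * x $$ (p, q) * u q"
  using assms by (simp add: mat_diag_mult_left[of _ n n] mat_diag_mult_right[of _ n n])

text \<open>The conjugating pair \<open>b\<close>, \<open>b'\<close> is part of the conclusion, and
  not just a point of the orbit, because the description of all normal forms composes further
  elements with it.\<close>

lemma C_tilde_normal_form:
  assumes "(r, S, i, j) \<in> C_tilde \<alpha>" "diagonalizable_mat r"
  obtains b b' s \<rho> \<sigma> where "b \<in> parabolic \<alpha>" "b' \<in> parabolic \<alpha>"
    "b * b' = 1\<^sub>m (sum_list \<alpha>)" "b' * b = 1\<^sub>m (sum_list \<alpha>)"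
    "s \<in> carrier_mat (sum_list \<alpha>) (sum_list \<alpha>)" "S = cls \<alpha> s"
    "inj_on \<rho> {..<sum_list \<alpha>}"
    "b * r * b' = mat_diag (sum_list \<alpha>) (\<lambda>p. - \<rho> p)"
    "cls \<alpha> (b * s * b') = cls \<alpha> (block_lower_CM \<alpha> \<rho> \<sigma>)"
    "b * i = Matrix.mat (sum_list \<alpha>) 1 (\<lambda>_. - 1)"
    "j * b' = Matrix.mat 1 (sum_list \<alpha>) (\<lambda>_. 1)"
proof -
  define n where "n = sum_list \<alpha>"
  obtain s where r: "r \<in> parabolic \<alpha>" and s: "s \<in> carrier_mat n n" and S: "S = cls \<alpha> s"
    and i: "i \<in> carrier_mat n 1" and j: "j \<in> carrier_mat 1 n"
    and eq: "cls \<alpha> ((r * s - s * r) + 1\<^sub>m n) = cls \<alpha> (- (i * j))"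
    using assms(1) by (auto simp: C_tilde_def Let_def n_def)
  have rc: "r \<in> carrier_mat n n" using r by (simp add: parabolic_iff n_def)
  \<comment> \<open>The equality of cosets becomes the membership of one matrix in the nilradical, a
    condition that survives conjugation.\<close>
  define M where "M = r * s - s * r + 1\<^sub>m n + i * j"
  have "M \<in> nilradical \<alpha>"
    unfolding nilradical_iff n_def[symmetric]
  proof (intro conjI allI impI)
    show "M \<in> carrier_mat n n" using rc s i j by (simp add: M_def)
    fix p q assume pq: "p < n" "q < n" "block_index \<alpha> q \<le> block_index \<alpha> p"
    have "((r * s - s * r) + 1\<^sub>m n) $$ (p, q) = (- (i * j)) $$ (p, q)"
      using eq pq rc s i j by (subst (asm) cls_eq_iff) (auto simp: n_def)
    then show "M $$ (p, q) = 0"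
      using pq rc s i j by (simp add: M_def)
  qed
  obtain B C d where B: "B \<in> parabolic \<alpha>" and C: "C \<in> parabolic \<alpha>"
    and BC: "B * C = 1\<^sub>m n" "C * B = 1\<^sub>m n" and CrB: "C * r * B = mat_diag n d"
    using parabolic_diagonalization[OF r assms(2)] unfolding n_def by metis
  have c: "B \<in> carrier_mat n n" "C \<in> carrier_mat n n"
    using B C by (simp_all add: parabolic_iff n_def)
  define s1 where "s1 = C * s * B"
  define i1 where "i1 p = (C * i) $$ (p, 0)" for p
  define t where "t p = (j * B) $$ (0, p)" for p
  have s1: "s1 \<in> carrier_mat n n" using c s by (simp add: s1_def)
  have CMB: "C * M * B \<in> nilradical \<alpha>"
    using B C \<open>M \<in> nilradical \<alpha>\<close> by (intro mult_mem_nilradical_left mult_mem_nilradical_right)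
  have "C * M * B = mat_diag n d * s1 - s1 * mat_diag n d + 1\<^sub>m n + (C * i) * (j * B)"
    unfolding M_def s1_def CrB[symmetric]
    using moment_map_conjugate[OF c(2,1) BC(2,1) rc s i j] .
  moreover have "((C * i) * (j * B)) $$ (p, q) = i1 p * t q" if "p < n" "q < n" for p q
    using c i j that by (subst index_mult_mat_sum[of _ n 1 _ n]) (auto simp: i1_def t_def)
  ultimately have "(C * M * B) $$ (p, q) =
      d p * s1 $$ (p, q) - s1 $$ (p, q) * d q + (if p = q then 1 else 0) + i1 p * t q"
    if "p < n" "q < n" for p q
    using that s1 c i j
    by (simp add: mat_diag_mult_left[of _ n n] mat_diag_mult_right[of _ n n])
  then have entry: "d p * s1 $$ (p, q) - s1 $$ (p, q) * d q + (if p = q then 1 else 0) + i1 p * t q = 0"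
    if "p < n" "q < n" "block_index \<alpha> q \<le> block_index \<alpha> p" for p q
    using CMB that by (simp add: nilradical_iff n_def)
  have it: "t p * i1 p = - 1" if "p < n" for p
    using entry[of p p] that by (simp add: algebra_simps eq_neg_iff_add_eq_0)
  then have t0: "t p \<noteq> 0" and i0: "i1 p \<noteq> 0" if "p < n" for p
    using that by fastforce+
  have offdiag: "(d p - d q) * s1 $$ (p, q) = - (i1 p * t q)"
    if "p < n" "q < n" "block_index \<alpha> q \<le> block_index \<alpha> p" "p \<noteq> q" for p q
    using entry[OF that(1-3)] that(4) by (simp add: algebra_simps eq_neg_iff_add_eq_0)
  have dne: "d p \<noteq> d q" if "p < n" "q < n" "p \<noteq> q" for p q
  proof (cases "block_index \<alpha> q \<le> block_index \<alpha> p")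
    case True
    show ?thesis using offdiag[OF that(1,2) True that(3)] t0[of q] i0[of p] that by auto
  next
    case False
    then show ?thesis using offdiag[of q p] t0[of p] i0[of q] that by auto
  qed
  \<comment> \<open>Rescaling by t turns the row \<open>j * B\<close> into ones, and by
    \<open>t p * i1 p = - 1\<close> it turns the column \<open>C * i\<close> into entries -1 at the
    same time. The diagonal entries of \<open>s1\<close> do not change.\<close>
  define b where "b = mat_diag n t * C"
  define b' where "b' = B * mat_diag n (\<lambda>p. 1 / t p)"
  have D: "mat_diag n t * mat_diag n (\<lambda>p. 1 / t p) = 1\<^sub>m n"
    using t0 by (intro eq_matI) (auto simp: mat_diag_mult_left[of _ n n] mat_diag_index carrier_matD[OF mat_diag_dim])
  have Dp: "mat_diag n f \<in> parabolic \<alpha>" for f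
    by (auto simp: parabolic_iff n_def mat_diag_index)
  have bP: "b \<in> parabolic \<alpha>" "b' \<in> parabolic \<alpha>"
    unfolding b_def b'_def using B C Dp by (auto intro: mult_mem_parabolic)
  then have bc: "b \<in> carrier_mat n n" "b' \<in> carrier_mat n n"
    by (simp_all add: parabolic_iff n_def)
  have conj: "b * x * b' = mat_diag n t * (C * x * B) * mat_diag n (\<lambda>p. 1 / t p)"
    if "x \<in> carrier_mat n n" for x
    unfolding b_def b'_def using that c mat_diag_dim[of n t] mat_diag_dim[of n "\<lambda>p. 1 / t p"]
    by (simp add: assoc_mult_mat[of _ n n _ n _ n])
  have "b * b' = b * 1\<^sub>m n * b'" using bc by simp
  also have "\<dots> = 1\<^sub>m n"
    using conj[of "1\<^sub>m n"] c BC D right_mult_one_mat[OF mat_diag_dim[of n t]]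
    by (simp del: mat_diag_diag)
  finally have bb': "b * b' = 1\<^sub>m n" .
  have b'b: "b' * b = 1\<^sub>m n" by (rule mat_mult_left_right_inverse[OF bc bb'])
  \<comment> \<open>The double negation exhibits \<rho> p = - d p, as the convention r =
    diag(-\<rho>) demands.\<close>
  have "b * r * b' = mat_diag n (\<lambda>p. - (- d p))"
    unfolding conj[OF rc] CrB
    by (intro eq_matI) (auto simp: mat_diag_conjugate_index[OF mat_diag_dim] mat_diag_index t0
        carrier_matD[OF mat_diag_dim] simp del: mat_diag_diag)
  moreover have "cls \<alpha> (b * s * b') = cls \<alpha> (block_lower_CM \<alpha> (\<lambda>p. - d p) (\<lambda>p. s1 $$ (p, p)))"
  proof (subst cls_eq_iff, goal_cases)
    case 3
    show ?case
    proof (intro allI impI)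
      fix p q assume pq: "p < sum_list \<alpha>" "q < sum_list \<alpha>" "block_index \<alpha> q \<le> block_index \<alpha> p"
      have 1: "(b * s * b') $$ (p, q) = t p * s1 $$ (p, q) / t q"
        using pq s1 by (simp add: conj[OF s] s1_def[symmetric] n_def mat_diag_conjugate_index)
      show "(b * s * b') $$ (p, q) = block_lower_CM \<alpha> (\<lambda>p. - d p) (\<lambda>p. s1 $$ (p, p)) $$ (p, q)"
      proof (cases "p = q")
        case True
        then show ?thesis using pq t0[of p] 1 by (simp add: block_lower_CM_index n_def)
      next
        case False
        have "(d p - d q) * (t p * s1 $$ (p, q)) = t p * ((d p - d q) * s1 $$ (p, q))"
          by simp
        also have "\<dots> = - (t p * i1 p) * t q"
          using pq False by (simp add: offdiag n_def)
        also have "\<dots> = t q" using it pq by (simp add: n_def)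
        finally have "t p * s1 $$ (p, q) / t q = inverse (d p - d q)"
          using dne[of p q] t0[of q] pq False by (simp add: n_def field_simps)
        then show ?thesis using pq False by (simp add: 1 block_lower_CM_index)
      qed
    qed
  qed (use bc s in \<open>simp_all add: n_def\<close>)
  moreover have "b * i = Matrix.mat n 1 (\<lambda>_. - 1)"
  proof (rule eq_matI)
    fix p q assume "p < dim_row (Matrix.mat n 1 (\<lambda>_. - 1 :: complex))"
      "q < dim_col (Matrix.mat n 1 (\<lambda>_. - 1 :: complex))"
    then have pq: "p < n" "q = 0" by auto
    have "b * i = mat_diag n t * (C * i)"
      unfolding b_def using c i mat_diag_dim[of n t] by (intro assoc_mult_mat)
    then show "(b * i) $$ (p, q) = Matrix.mat n 1 (\<lambda>_. - 1) $$ (p, q)"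
      using pq c i it[of p] by (simp add: mat_diag_mult_left[of _ n 1] i1_def)
  qed (use bc i in auto)
  moreover have "j * b' = Matrix.mat 1 n (\<lambda>_. 1)"
  proof (rule eq_matI)
    fix p q assume "p < dim_row (Matrix.mat 1 n (\<lambda>_. 1 :: complex))"
      "q < dim_col (Matrix.mat 1 n (\<lambda>_. 1 :: complex))"
    then have pq: "p = 0" "q < n" by auto
    have "j * b' = (j * B) * mat_diag n (\<lambda>p. 1 / t p)"
      unfolding b'_def using c j mat_diag_dim[of n "\<lambda>p. 1 / t p"]
      by (intro assoc_mult_mat[symmetric])
    then show "(j * b') $$ (p, q) = Matrix.mat 1 n (\<lambda>_. 1) $$ (p, q)"
      using pq c j t0[of q] by (simp add: mat_diag_mult_right[of _ 1 n] t_def)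
  qed (use bc j in auto)
  moreover have "inj_on (\<lambda>p. - d p) {..<n}"
    using dne by (auto simp: inj_on_def)
  ultimately show ?thesis
    using that bP bb' b'b s S unfolding n_def by blast
qed

section \<open>Permutation matrices and spectra\<close>

text \<open>With the ones at (p, \<pi> p), conjugation substitutes \<pi> into both indices. This
  fits \<open>\<rho>' p = \<rho> (\<pi> p)\<close> without passing to the inverse
  permutation.\<close>

definition perm_mat :: "nat \<Rightarrow> (nat \<Rightarrow> nat) \<Rightarrow> complex mat" where
  "perm_mat n \<pi> = Matrix.mat n n (\<lambda>(p, q). if q = \<pi> p then 1 else 0)"

lemma perm_mat_carrier [simp]: "perm_mat n \<pi> \<in> carrier_mat n n"
  by (simp add: perm_mat_def)

lemma perm_mat_transpose_carrier [simp]: "transpose_mat (perm_mat n \<pi>) \<in> carrier_mat n n"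
  by simp

lemma permutes_lessThan: "\<pi> permutes {..<n} \<Longrightarrow> p < n \<Longrightarrow> \<pi> p < (n :: nat)"
  using permutes_in_image by fastforce

lemma perm_mat_mult_index:
  assumes "\<pi> permutes {..<n}" "x \<in> carrier_mat n m" "p < n" "q < m"
  shows "(perm_mat n \<pi> * x) $$ (p, q) = x $$ (\<pi> p, q)"
proof -
  have "(perm_mat n \<pi> * x) $$ (p, q) = (\<Sum>u<n. perm_mat n \<pi> $$ (p, u) * x $$ (u, q))"
    using assms by (intro index_mult_mat_sum) auto
  also have "\<dots> = (\<Sum>u<n. if u = \<pi> p then x $$ (\<pi> p, q) else 0)"
    using assms by (intro sum.cong) (auto simp: perm_mat_def)
  finally show ?thesis using permutes_lessThan[OF assms(1,3)] by simp
qed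

lemma mult_perm_mat_transpose_index:
  assumes "\<pi> permutes {..<n}" "x \<in> carrier_mat m n" "p < m" "q < n"
  shows "(x * transpose_mat (perm_mat n \<pi>)) $$ (p, q) = x $$ (p, \<pi> q)"
proof -
  have "(x * transpose_mat (perm_mat n \<pi>)) $$ (p, q) =
      (\<Sum>u<n. x $$ (p, u) * transpose_mat (perm_mat n \<pi>) $$ (u, q))"
    using assms by (intro index_mult_mat_sum) auto
  also have "\<dots> = (\<Sum>u<n. if u = \<pi> q then x $$ (p, \<pi> q) else 0)"
    using assms by (intro sum.cong) (auto simp: perm_mat_def)
  finally show ?thesis using permutes_lessThan[OF assms(1,4)] by simp
qed

lemma perm_mat_conjugate_index:
  assumes "\<pi> permutes {..<n}" "x \<in> carrier_mat n n" "p < n" "q < n"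
  shows "(perm_mat n \<pi> * x * transpose_mat (perm_mat n \<pi>)) $$ (p, q) = x $$ (\<pi> p, \<pi> q)"
  using assms permutes_lessThan[OF assms(1)]
    mult_perm_mat_transpose_index[OF assms(1) mult_carrier_mat[OF perm_mat_carrier assms(2)] assms(3,4)]
  by (simp add: perm_mat_mult_index[where m = n])

lemma perm_mat_inverse:
  assumes "\<pi> permutes {..<n}"
  shows "perm_mat n \<pi> * transpose_mat (perm_mat n \<pi>) = 1\<^sub>m n"
    "transpose_mat (perm_mat n \<pi>) * perm_mat n \<pi> = 1\<^sub>m n"
proof -
  show 1: "perm_mat n \<pi> * transpose_mat (perm_mat n \<pi>) = 1\<^sub>m n"
  proof (rule eq_matI)
    fix p q assume "p < dim_row (1\<^sub>m n :: complex mat)" "q < dim_col (1\<^sub>m n :: complex mat)"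
    then have pq: "p < n" "q < n" by auto
    have "\<pi> p = \<pi> q \<longleftrightarrow> p = q" using permutes_inj[OF assms] by (auto simp: inj_eq)
    then show "(perm_mat n \<pi> * transpose_mat (perm_mat n \<pi>)) $$ (p, q) = 1\<^sub>m n $$ (p, q)"
      using perm_mat_mult_index[OF assms perm_mat_transpose_carrier pq] permutes_lessThan[OF assms] pq
      by (auto simp: perm_mat_def)
  qed (simp_all add: perm_mat_def)
  show "transpose_mat (perm_mat n \<pi>) * perm_mat n \<pi> = 1\<^sub>m n"
    by (rule mat_mult_left_right_inverse[OF _ _ 1]) simp_all
qed

lemma spectrum_mat_diag: "spectrum (mat_diag n d) = d ` {..<n}" for d :: "nat \<Rightarrow> complex"
proof -
  have "upper_triangular (mat_diag n d)"
    by (auto simp: mat_diag_index carrier_matD[OF mat_diag_dim])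
  moreover have "diag_mat (mat_diag n d) = map d [0..<n]"
    by (auto simp: diag_mat_def mat_diag_index carrier_matD[OF mat_diag_dim])
  ultimately have "char_poly (mat_diag n d) = (\<Prod>a\<leftarrow>map d [0..<n]. [:- a, 1:])"
    using char_poly_upper_triangular[OF mat_diag_dim] by metis
  then show ?thesis
    by (auto simp: spectrum_root_char_poly[OF mat_diag_dim] poly_prod_list prod_list_zero_iff)
qed

lemma spectrum_conjugate_diag:
  assumes "b \<in> carrier_mat n n" "b' \<in> carrier_mat n n" "b * b' = 1\<^sub>m n" "b' * b = 1\<^sub>m n"
    "r \<in> carrier_mat n n" "b * r * b' = mat_diag n (d :: nat \<Rightarrow> complex)"
  shows "spectrum r = d ` {..<n}"
proof -
  have "similar_mat_wit (mat_diag n d) r b b'"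
    using assms by (intro similar_mat_witI[of _ _ n]) auto
  then have "char_poly (mat_diag n d) = char_poly r"
    by (intro char_poly_similar) (auto simp: similar_mat_def)
  then have "spectrum r = spectrum (mat_diag n d)"
    using assms(5) by (simp add: spectrum_root_char_poly[of _ n] mat_diag_dim)
  then show ?thesis by (simp add: spectrum_mat_diag)
qed

section \<open>All normal forms in one orbit\<close>

text \<open>The normalizing element b is followed by the permutation matrix of \<pi>. That matrix
  lies in the parabolic algebra because \<pi> preserves blocks, it fixes the constant vectors, and
  it permutes the lower block positions among themselves.\<close>

lemma CM_point_mem_orbit_permute:
  assumes b: "b \<in> parabolic \<alpha>" "b' \<in> parabolic \<alpha>"
    "b * b' = 1\<^sub>m (sum_list \<alpha>)" "b' * b = 1\<^sub>m (sum_list \<alpha>)"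
    and c: "r \<in> carrier_mat (sum_list \<alpha>) (sum_list \<alpha>)" "s \<in> carrier_mat (sum_list \<alpha>) (sum_list \<alpha>)"
      "i \<in> carrier_mat (sum_list \<alpha>) 1" "j \<in> carrier_mat 1 (sum_list \<alpha>)"
    and s: "s \<in> S"
    and r: "b * r * b' = mat_diag (sum_list \<alpha>) (\<lambda>p. - \<rho> p)"
    and CM: "cls \<alpha> (b * s * b') = cls \<alpha> (block_lower_CM \<alpha> \<rho> \<sigma>)"
    and i: "b * i = Matrix.mat (sum_list \<alpha>) 1 (\<lambda>_. - 1)"
    and j: "j * b' = Matrix.mat 1 (sum_list \<alpha>) (\<lambda>_. 1)"
    and \<pi>: "\<pi> \<in> young_subgroup \<alpha>"
    and eq: "\<And>p. p < sum_list \<alpha> \<Longrightarrow> \<rho>' p = \<rho> (\<pi> p) \<and> \<sigma>' p = \<sigma> (\<pi> p)"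
  shows "CM_point \<alpha> \<rho>' \<sigma>' \<in> P_orbit \<alpha> (r, S, i, j)"
proof -
  define n where "n = sum_list \<alpha>"
  define e where "e = perm_mat n \<pi>"
  define e' where "e' = transpose_mat e"
  have perm: "\<pi> permutes {..<n}" and blk: "\<And>p. p < n \<Longrightarrow> block_index \<alpha> (\<pi> p) = block_index \<alpha> p"
    using \<pi> by (auto simp: young_subgroup_iff n_def)
  note lt = permutes_lessThan[OF perm]
  have \<pi>_eq: "\<pi> p = \<pi> q \<longleftrightarrow> p = q" for p q using permutes_inj[OF perm] by (auto simp: inj_eq)
  have ec: "e \<in> carrier_mat n n" "e' \<in> carrier_mat n n" by (simp_all add: e_def e'_def)
  have bc: "b \<in> carrier_mat n n" "b' \<in> carrier_mat n n"
    using b by (simp_all add: parabolic_iff n_def)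
  note c = c[folded n_def]
  have ee: "e * e' = 1\<^sub>m n" by (simp add: e_def e'_def perm_mat_inverse perm)
  have "e \<in> parabolic \<alpha>" using ec blk by (auto simp: parabolic_iff n_def e_def perm_mat_def)
  then have eb: "e * b \<in> parabolic \<alpha>" using b(1) by (rule mult_mem_parabolic)
  have "e * b * (b' * e') = e * (b * b') * e'"
    using ec bc by (simp add: assoc_mult_mat[of _ n n _ n _ n])
  then have inv: "e * b * (b' * e') = 1\<^sub>m n" using ec ee b(3) by (simp add: n_def)
  have inv': "b' * e' * (e * b) = 1\<^sub>m n"
    by (rule mat_mult_left_right_inverse[OF _ _ inv]) (use ec bc in auto)
  have conj: "(e * b) * x * (b' * e') = e * (b * x * b') * e'" if "x \<in> carrier_mat n n" for x
    using that ec bc by (simp add: assoc_mult_mat[of _ n n _ n _ n])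
  have conj_index: "((e * b) * x * (b' * e')) $$ (p, q) = (b * x * b') $$ (\<pi> p, \<pi> q)"
    if "x \<in> carrier_mat n n" "p < n" "q < n" for x p q
    unfolding conj[OF that(1)] unfolding e_def e'_def
    by (rule perm_mat_conjugate_index[OF perm _ that(2,3)]) (use that(1) bc in auto)
  have 1: "mat_diag n (\<lambda>p. - \<rho>' p) = (e * b) * r * (b' * e')"
  proof (rule eq_matI)
    fix p q assume "p < dim_row ((e * b) * r * (b' * e'))" "q < dim_col ((e * b) * r * (b' * e'))"
    then have "p < n" "q < n" using ec by auto
    then show "mat_diag n (\<lambda>p. - \<rho>' p) $$ (p, q) = ((e * b) * r * (b' * e')) $$ (p, q)"
      using c r lt eq by (simp add: conj_index mat_diag_index \<pi>_eq n_def)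
  qed (use ec in \<open>auto simp: carrier_matD[OF mat_diag_dim]\<close>)
  have 2: "cls \<alpha> (block_lower_CM \<alpha> \<rho>' \<sigma>') = cls \<alpha> ((e * b) * s * (b' * e'))"
  proof (subst cls_eq_iff, goal_cases)
    case 3
    show ?case
    proof (intro allI impI)
      fix p q assume pq: "p < sum_list \<alpha>" "q < sum_list \<alpha>" "block_index \<alpha> q \<le> block_index \<alpha> p"
      then have pq': "p < n" "q < n" by (simp_all add: n_def)
      have "((e * b) * s * (b' * e')) $$ (p, q) = (b * s * b') $$ (\<pi> p, \<pi> q)"
        using c pq' by (simp add: conj_index)
      also have "\<dots> = block_lower_CM \<alpha> \<rho> \<sigma> $$ (\<pi> p, \<pi> q)"
        using CM c bc lt[OF pq'(1)] lt[OF pq'(2)] blk[OF pq'(1)] blk[OF pq'(2)] pq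
        by (subst (asm) cls_eq_iff) (auto simp: n_def)
      also have "\<dots> = block_lower_CM \<alpha> \<rho>' \<sigma>' $$ (p, q)"
        using lt[OF pq'(1)] lt[OF pq'(2)] blk[OF pq'(1)] blk[OF pq'(2)] pq eq
        by (simp add: block_lower_CM_index \<pi>_eq n_def)
      finally show "block_lower_CM \<alpha> \<rho>' \<sigma>' $$ (p, q) = ((e * b) * s * (b' * e')) $$ (p, q)" ..
    qed
  qed (use ec bc c in \<open>auto simp: n_def\<close>)
  have 3: "Matrix.mat n 1 (\<lambda>_. - 1) = (e * b) * i"
  proof (rule eq_matI)
    fix p q assume "p < dim_row ((e * b) * i)" "q < dim_col ((e * b) * i)"
    then have pq: "p < n" "q < 1" using ec c by auto
    have "((e * b) * i) $$ (p, q) = (b * i) $$ (\<pi> p, q)"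
      using perm_mat_mult_index[OF perm, of "b * i" 1 p q] pq bc c assoc_mult_mat[OF ec(1) bc(1) c(3)]
      by (simp add: e_def)
    then show "Matrix.mat n 1 (\<lambda>_. - 1) $$ (p, q) = ((e * b) * i) $$ (p, q)"
      using pq lt i by (simp add: n_def)
  qed (use ec c in auto)
  have 4: "Matrix.mat 1 n (\<lambda>_. 1) = j * (b' * e')"
  proof (rule eq_matI)
    fix p q assume "p < dim_row (j * (b' * e'))" "q < dim_col (j * (b' * e'))"
    then have pq: "p < 1" "q < n" using ec c by auto
    have "j * (b' * e') = j * b' * e'"
      using ec bc c by simp
    then have "(j * (b' * e')) $$ (p, q) = (j * b') $$ (p, \<pi> q)"
      using mult_perm_mat_transpose_index[OF perm, of "j * b'" 1 p q] pq ec bc c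
      by (simp add: e_def e'_def)
    then show "Matrix.mat 1 n (\<lambda>_. 1) $$ (p, q) = (j * (b' * e')) $$ (p, q)"
      using pq lt j by (simp add: n_def)
  qed (use ec c in auto)
  have "b' * e' \<in> carrier_mat n n" using bc ec by simp
  then show ?thesis
    unfolding CM_point_def Let_def P_orbit_iff
    using eb inv inv' s 1 2 3 4 unfolding n_def by blast
qed

text \<open>
  An element of \<open>P\<close> conjugating one diagonal matrix with distinct entries to another one is a monomial
  matrix, and fixing the vector \<open>(-1, ..., -1)\<close> makes it a permutation matrix. Membership in the
  parabolic only allows the block index to grow along the permutation, so it is constant.
\<close>

lemma CM_point_orbit_unique:
  assumes b: "b \<in> parabolic \<alpha>" "b' \<in> parabolic \<alpha>"
    "b * b' = 1\<^sub>m (sum_list \<alpha>)" "b' * b = 1\<^sub>m (sum_list \<alpha>)"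
    and c: "r \<in> carrier_mat (sum_list \<alpha>) (sum_list \<alpha>)" "s \<in> carrier_mat (sum_list \<alpha>) (sum_list \<alpha>)"
      "i \<in> carrier_mat (sum_list \<alpha>) 1"
    and inj: "inj_on \<rho> {..<sum_list \<alpha>}"
    and r: "b * r * b' = mat_diag (sum_list \<alpha>) (\<lambda>p. - \<rho> p)"
    and CM: "cls \<alpha> (b * s * b') = cls \<alpha> (block_lower_CM \<alpha> \<rho> \<sigma>)"
    and i: "b * i = Matrix.mat (sum_list \<alpha>) 1 (\<lambda>_. - 1)"
    and orbit: "CM_point \<alpha> \<rho>' \<sigma>' \<in> P_orbit \<alpha> (r, cls \<alpha> s, i, j)"
  shows "\<exists>\<pi>\<in>young_subgroup \<alpha>. \<forall>p<sum_list \<alpha>. \<rho>' p = \<rho> (\<pi> p) \<and> \<sigma>' p = \<sigma> (\<pi> p)"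
proof -
  define n where "n = sum_list \<alpha>"
  obtain a a' x where a: "a \<in> parabolic \<alpha>" and a': "a' \<in> carrier_mat n n"
    "a * a' = 1\<^sub>m n" "a' * a = 1\<^sub>m n" and x: "x \<in> cls \<alpha> s"
    and ra: "mat_diag n (\<lambda>p. - \<rho>' p) = a * r * a'"
    and xa: "cls \<alpha> (block_lower_CM \<alpha> \<rho>' \<sigma>') = cls \<alpha> (a * x * a')"
    and ia: "Matrix.mat n 1 (\<lambda>_. - 1) = a * i"
    using orbit unfolding CM_point_def Let_def P_orbit_iff n_def by blast
  note c = c[folded n_def]
  have ac: "a \<in> carrier_mat n n" using a by (simp add: parabolic_iff n_def)
  have bc: "b \<in> carrier_mat n n" "b' \<in> carrier_mat n n"
    using b by (simp_all add: parabolic_iff n_def)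
  have xc: "x \<in> carrier_mat n n" using x c(2) by (simp add: mem_cls_iff n_def)
  note bb = b(3,4)[folded n_def]
  \<comment> \<open>The quotient of the two normalizing elements, which carries the normal form of
    (\<rho>, \<sigma>) to that of (\<rho>', \<sigma>').\<close>
  define e where "e = a * b'"
  define e' where "e' = b * a'"
  have eP: "e \<in> parabolic \<alpha>" unfolding e_def using a b(2) by (rule mult_mem_parabolic)
  have ec: "e \<in> carrier_mat n n" "e' \<in> carrier_mat n n" using ac a' bc by (simp_all add: e_def e'_def)
  have "e' * e = b * (a' * a) * b'"
    unfolding e_def e'_def using ac a'(1) bc by (simp add: assoc_mult_mat[of _ n n _ n _ n])
  then have e'e: "e' * e = 1\<^sub>m n" using a' bc bb by simp
  have eb: "e * b = a"
  proof -
    have "e * b = a * (b' * b)" unfolding e_def using ac bc by (simp add: assoc_mult_mat[of _ n n _ n _ n])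
    then show ?thesis using ac bb by simp
  qed
  have be: "b' * e' = a'"
  proof -
    have "b' * e' = b' * b * a'" unfolding e'_def using a'(1) bc by (simp add: assoc_mult_mat[of _ n n _ n _ n])
    then show ?thesis using a' bb by simp
  qed
  have conj: "a * y * a' = e * (b * y * b') * e'" if "y \<in> carrier_mat n n" for y
    unfolding eb[symmetric] be[symmetric] using that ec bc by (simp add: assoc_mult_mat[of _ n n _ n _ n])
  have "mat_diag n (\<lambda>p. - \<rho>' p) * e = e * (b * r * b') * e' * e"
    using ra conj[OF c(1)] by simp
  also have "\<dots> = e * (b * r * b') * (e' * e)"
    using ec bc c by (simp add: assoc_mult_mat[of _ n n _ n _ n])
  also have "\<dots> = e * mat_diag n (\<lambda>p. - \<rho> p)"
    using ec e'e r right_mult_one_mat[of "e * mat_diag n (\<lambda>p. - \<rho> p)" n n] mult_carrier_mat[OF ec(1) mat_diag_dim]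
    by (simp add: n_def)
  finally have "mat_diag n (\<lambda>p. - \<rho>' p) * e = e * mat_diag n (\<lambda>p. - \<rho> p)" .
  then have entry: "(mat_diag n (\<lambda>p. - \<rho>' p) * e) $$ (p, q) = (e * mat_diag n (\<lambda>p. - \<rho> p)) $$ (p, q)" for p q
    by (rule arg_cong)
  \<comment> \<open>As e intertwines the two diagonal matrices, a nonzero entry pairs equal
    eigenvalues; injectivity of \<rho> then leaves at most one such column in each row.\<close>
  have "\<rho>' p * e $$ (p, q) = e $$ (p, q) * \<rho> q" if "p < n" "q < n" for p q
    using entry[of p q] ec(1) that
    by (simp add: mat_diag_mult_left[of _ n n] mat_diag_mult_right[of _ n n])
  then have mono: "\<rho>' p = \<rho> q" if "p < n" "q < n" "e $$ (p, q) \<noteq> 0" for p q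
    using that by (metis mult.commute mult_cancel_left)
  have row_sum: "(\<Sum>q<n. e $$ (p, q)) = 1" if p: "p < n" for p
  proof -
    have "e * (b * i) = a * i" unfolding eb[symmetric] using ec bc c by (simp add: assoc_mult_mat[of _ n n _ n _ 1])
    then have "(e * (b * i)) $$ (p, 0) = - 1" using p by (simp add: ia[symmetric])
    moreover have "(e * (b * i)) $$ (p, 0) = (\<Sum>q<n. e $$ (p, q) * (b * i) $$ (q, 0))"
      using ec bc c p by (intro index_mult_mat_sum) auto
    ultimately have "(\<Sum>q<n. - (e $$ (p, q))) = - 1" using i by (simp add: n_def)
    then show ?thesis by (simp only: sum_negf neg_equal_iff_equal)
  qed
  have "\<exists>q<n. e $$ (p, q) \<noteq> 0" if "p < n" for p
    using row_sum[OF that] by (metis lessThan_iff sum.neutral zero_neq_one)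
  then obtain f where f: "\<And>p. p < n \<Longrightarrow> f p < n \<and> e $$ (p, f p) \<noteq> 0" by metis
  \<comment> \<open>The identity outside the range is what \<open>permutes\<close> asks for.\<close>
  define \<pi> where "\<pi> p = (if p < n then f p else p)" for p
  have \<pi>: "\<pi> p < n" "e $$ (p, \<pi> p) \<noteq> 0" if "p < n" for p using f that by (simp_all add: \<pi>_def)
  have zero: "e $$ (p, q) = 0" if "p < n" "q < n" "q \<noteq> \<pi> p" for p q
    using mono[of p q] mono[of p "\<pi> p"] \<pi>[of p] that inj by (auto simp: inj_on_def n_def)
  have e1: "e $$ (p, \<pi> p) = 1" if "p < n" for p
  proof -
    have "(\<Sum>q<n. e $$ (p, q)) = (\<Sum>q<n. if q = \<pi> p then e $$ (p, \<pi> p) else 0)"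
      using zero that by (intro sum.cong) auto
    then show ?thesis using row_sum \<pi> that by simp
  qed
  \<comment> \<open>A column missed by \<pi> would be a zero column of the invertible matrix
    e.\<close>
  have "{..<n} \<subseteq> \<pi> ` {..<n}"
  proof (rule ccontr)
    assume "\<not> ?thesis"
    then obtain q where q: "q < n" "\<And>p. p < n \<Longrightarrow> q \<noteq> \<pi> p" by auto
    have "(e' * e) $$ (q, q) = (\<Sum>u<n. e' $$ (q, u) * e $$ (u, q))"
      using ec q by (intro index_mult_mat_sum) auto
    also have "\<dots> = 0" using q zero by (intro sum.neutral) auto
    finally show False using e'e q(1) by simp
  qed
  then have im: "\<pi> ` {..<n} = {..<n}" using \<pi> by auto
  then have bij: "bij_betw \<pi> {..<n} {..<n}"
    by (simp add: bij_betw_def eq_card_imp_inj_on)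
  then have perm: "\<pi> permutes {..<n}"
    by (rule bij_imp_permutes) (simp add: \<pi>_def)
  have e_eq: "e = perm_mat n \<pi>"
    using ec e1 zero by (intro eq_matI) (auto simp: perm_mat_def)
  have le: "block_index \<alpha> p \<le> block_index \<alpha> (\<pi> p)" if "p < n" for p
    using eP \<pi>[OF that] that by (force simp: parabolic_iff n_def not_less[symmetric])
  \<comment> \<open>A permutation does not change the total of all block indices, so the inequality
    at each index cannot be strict anywhere.\<close>
  have "(\<Sum>p<n. block_index \<alpha> p) = (\<Sum>p<n. block_index \<alpha> (\<pi> p))"
    by (rule sum.reindex_bij_betw[OF bij, symmetric])
  then have "block_index \<alpha> p = block_index \<alpha> (\<pi> p)" if "p < n" for p
    by (rule sum_mono_inv) (use le that in auto)
  then have young: "\<pi> \<in> young_subgroup \<alpha>"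
    using perm by (simp add: young_subgroup_iff n_def)
  have e'_eq: "e' = transpose_mat e"
  proof -
    have "e' = e' * (e * transpose_mat e)"
      using ec perm_mat_inverse(1)[OF perm] by (simp add: e_eq)
    also have "\<dots> = e' * e * transpose_mat e" using ec by (simp add: assoc_mult_mat[of _ n n _ n _ n])
    finally show ?thesis using e'e ec by simp
  qed
  have "\<rho>' p = \<rho> (\<pi> p) \<and> \<sigma>' p = \<sigma> (\<pi> p)" if p: "p < n" for p
  proof
    show "\<rho>' p = \<rho> (\<pi> p)" using mono \<pi> p by blast
    have "\<sigma>' p = block_lower_CM \<alpha> \<rho>' \<sigma>' $$ (p, p)"
      using p by (simp add: block_lower_CM_index n_def)
    also have "\<dots> = (a * x * a') $$ (p, p)"
      using xa ac xc a' p by (subst (asm) cls_eq_iff) (auto simp: n_def)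
    also have "\<dots> = (b * x * b') $$ (\<pi> p, \<pi> p)"
      using perm_mat_conjugate_index[OF perm, of "b * x * b'" p p] bc xc p
      by (simp add: conj e'_eq e_eq)
    also have "\<dots> = block_lower_CM \<alpha> \<rho> \<sigma> $$ (\<pi> p, \<pi> p)"
    proof -
      \<comment> \<open>The representative x taken by the orbit may differ from s by an element of
        the nilradical; conjugation by b keeps the difference there, and diagonal positions do not
        see it.\<close>
      have "cls \<alpha> (b * x * b') = cls \<alpha> (block_lower_CM \<alpha> \<rho> \<sigma>)"
        using cls_conjugate[OF b(1,2) _ x] c(2) CM by (simp add: n_def)
      then show ?thesis
        using bc xc \<pi> p by (subst (asm) cls_eq_iff) (auto simp: n_def)
    qed
    also have "\<dots> = \<sigma> (\<pi> p)" using \<pi> p by (simp add: block_lower_CM_index n_def)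
    finally show "\<sigma>' p = \<sigma> (\<pi> p)" .
  qed
  then show ?thesis using young by (auto simp: n_def)
qed

text \<open>The spectrum is a set, so its cardinality n expresses that the eigenvalues are distinct.
  Uniqueness up to S_\<alpha> takes the form of an equivalence: the parameters of the normal forms
  in the orbit make up exactly one S_\<alpha>-class, compared only at indices below n.\<close>

theorem lemma6p4:
  fixes \<alpha> :: "nat list" and n :: nat
    and r\<^sub>0 i\<^sub>0 j\<^sub>0 :: "complex mat" and s\<^sub>0 :: "complex mat set"
  assumes "composition \<alpha> n"
    and "(r\<^sub>0, s\<^sub>0, i\<^sub>0, j\<^sub>0) \<in> C_tilde \<alpha>"
    and "diagonalizable_mat r\<^sub>0"
  shows "card (spectrum r\<^sub>0) = n \<and>
    (\<exists>\<rho> \<sigma>. CM_point \<alpha> \<rho> \<sigma> \<in> P_orbit \<alpha> (r\<^sub>0, s\<^sub>0, i\<^sub>0, j\<^sub>0) \<and>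
      (\<forall>\<rho>' \<sigma>'. CM_point \<alpha> \<rho>' \<sigma>' \<in> P_orbit \<alpha> (r\<^sub>0, s\<^sub>0, i\<^sub>0, j\<^sub>0) \<longleftrightarrow>
        (\<exists>\<pi>\<in>young_subgroup \<alpha>. \<forall>p<n. \<rho>' p = \<rho> (\<pi> p) \<and> \<sigma>' p = \<sigma> (\<pi> p))))"
proof -
  have n: "sum_list \<alpha> = n" using assms(1) by (simp add: composition_def)
  have c: "r\<^sub>0 \<in> carrier_mat n n" "i\<^sub>0 \<in> carrier_mat n 1" "j\<^sub>0 \<in> carrier_mat 1 n"
    using assms(2) by (auto simp: C_tilde_def Let_def n parabolic_iff)
  obtain b b' s \<rho> \<sigma> where b: "b \<in> parabolic \<alpha>" "b' \<in> parabolic \<alpha>" "b * b' = 1\<^sub>m n" "b' * b = 1\<^sub>m n"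
    and s: "s \<in> carrier_mat n n" "s\<^sub>0 = cls \<alpha> s" and inj: "inj_on \<rho> {..<n}"
    and nf: "b * r\<^sub>0 * b' = mat_diag n (\<lambda>p. - \<rho> p)"
      "cls \<alpha> (b * s * b') = cls \<alpha> (block_lower_CM \<alpha> \<rho> \<sigma>)"
      "b * i\<^sub>0 = Matrix.mat n 1 (\<lambda>_. - 1)" "j\<^sub>0 * b' = Matrix.mat 1 n (\<lambda>_. 1)"
    using C_tilde_normal_form[OF assms(2,3)] unfolding n by metis
  have bc: "b \<in> carrier_mat n n" "b' \<in> carrier_mat n n"
    using b by (simp_all add: parabolic_iff n)
  have mem: "s \<in> s\<^sub>0" using s by (simp add: mem_cls_iff n)
  have "spectrum r\<^sub>0 = (\<lambda>p. - \<rho> p) ` {..<n}"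
    using spectrum_conjugate_diag[OF bc b(3,4) c(1) nf(1)] .
  moreover have "inj_on (\<lambda>p. - \<rho> p) {..<n}" using inj by (auto simp: inj_on_def)
  ultimately have "card (spectrum r\<^sub>0) = n" by (simp add: card_image)
  moreover have perm: "CM_point \<alpha> \<rho>' \<sigma>' \<in> P_orbit \<alpha> (r\<^sub>0, s\<^sub>0, i\<^sub>0, j\<^sub>0)"
    if "\<pi> \<in> young_subgroup \<alpha>" "\<forall>p<n. \<rho>' p = \<rho> (\<pi> p) \<and> \<sigma>' p = \<sigma> (\<pi> p)" for \<pi> \<rho>' \<sigma>'
    using CM_point_mem_orbit_permute[where \<alpha> = \<alpha> and S = s\<^sub>0 and \<pi> = \<pi>, unfolded n,
        OF b c(1) s(1) c(2,3) mem nf] that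
    by blast
  moreover have "\<exists>\<pi>\<in>young_subgroup \<alpha>. \<forall>p<n. \<rho>' p = \<rho> (\<pi> p) \<and> \<sigma>' p = \<sigma> (\<pi> p)"
    if "CM_point \<alpha> \<rho>' \<sigma>' \<in> P_orbit \<alpha> (r\<^sub>0, s\<^sub>0, i\<^sub>0, j\<^sub>0)" for \<rho>' \<sigma>'
    using CM_point_orbit_unique[where \<alpha> = \<alpha>, unfolded n, OF b c(1) s(1) c(2) inj nf(1-3)] that
    unfolding s(2) by blast
  \<comment> \<open>Existence is the case of the identity permutation.\<close>
  moreover have "CM_point \<alpha> \<rho> \<sigma> \<in> P_orbit \<alpha> (r\<^sub>0, s\<^sub>0, i\<^sub>0, j\<^sub>0)"
    by (rule perm[of id]) (auto simp: young_subgroup_iff permutes_id)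
  ultimately show ?thesis by blast
qed

end
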